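(* Let $k\ge 3$ and $d$ be fixed integers with $d\ge 1$ and $k-4\le d\le k-1$. Then, as $n\to\infty$, $$f_d(k,n)\sim\left\{1-\left(\frac{k-1}{k}\right)^{k-d}\right\}\binom{n-d}{k-d}.$$
   Context: A $k$-graph ($k$-uniform hypergraph) is a pair $H=(V,E)$ with $V$ finite and $E\subseteq\binom{V}{k}$. A fractional matching in $H$ is a function $w:E\to[0,1]$ with $\sum_{e\ni v}w(e)\le 1$ for every $v\in V$; its size is $\sum_{e\in E}w(e)$, and $\nu^*(H)$ is the maximum size of a fractional matching. For $0\le d\le k-1$ and $S\in\binom{V}{d}$, $\deg_H(S)$ is the number of edges containing $S$, and $\delta_d(H)=\min_{S\in\binom Vd}\deg_H(S)$. $f_d(k,n)$ is the minimum $m$ such that every $n$-vertex $k$-graph $H$ with $\delta_d(H)\ge m$ satisfies $\nu^*(H)\ge n/k$ (i.e. has a perfect fractional matching). $a_n\sim b_n$ means $a_n/b_n\to1$ as $n\to\infty$. *)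

theory Defs
  imports Complex_Main "HOL-Library.Landau_Symbols"
begin

definition k_graph :: "nat \<Rightarrow> 'a set \<Rightarrow> 'a set set \<Rightarrow> bool" where
  "k_graph k V E \<longleftrightarrow> finite V \<and> E \<subseteq> {e. e \<subseteq> V \<and> card e = k}"

definition fractional_matching :: "'a set \<Rightarrow> 'a set set \<Rightarrow> ('a set \<Rightarrow> real) \<Rightarrow> bool" where
  "fractional_matching V E w \<longleftrightarrow>
     (\<forall>e\<in>E. 0 \<le> w e \<and> w e \<le> 1) \<and> (\<forall>v\<in>V. (\<Sum>e\<in>{e\<in>E. v \<in> e}. w e) \<le> 1)"

text \<open>
  The fractional matchings of a k-graph form a nonempty compact polytope in the space of
  functions from E to the reals, so the maximum size exists and is the supremum. Values of
  w outside E have no effect.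
\<close>
definition fractional_matching_number :: "'a set \<Rightarrow> 'a set set \<Rightarrow> real" where
  "fractional_matching_number V E = Sup {(\<Sum>e\<in>E. w e) | w. fractional_matching V E w}"

definition hdegree :: "'a set set \<Rightarrow> 'a set \<Rightarrow> nat" where
  "hdegree E S = card {e\<in>E. S \<subseteq> e}"

text \<open>
  Only meaningful for d at most the number of vertices; otherwise the minimum is over the
  empty set.
\<close>
definition min_degree :: "nat \<Rightarrow> 'a set \<Rightarrow> 'a set set \<Rightarrow> nat" where
  "min_degree d V E = Min (hdegree E ` {S. S \<subseteq> V \<and> card S = d})"

text \<open>
  Vertices are taken from the naturals without loss of generality, as every finite k-graph is
  isomorphic to one of these. For k and n at least d, the set of admissible m is nonempty, since the
  condition holds vacuously once m exceeds the binomial coefficient of n - d over k - d.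
\<close>
definition pfm_threshold :: "nat \<Rightarrow> nat \<Rightarrow> nat \<Rightarrow> nat" where
  "pfm_threshold d k n =
     (LEAST m. \<forall>(V :: nat set) E.
        k_graph k V E \<and> card V = n \<and> min_degree d V E \<ge> m \<longrightarrow>
          fractional_matching_number V E \<ge> real n / real k)"

end

theory Submission
  imports Defs
begin

text \<open>
  Put \<open>m = k - d\<close>. If a \<open>k\<close>-graph has no perfect fractional matching, Farkas' lemma
  yields vertex weights \<open>u\<close> of negative total that are nonnegative on every edge. Let \<open>S\<close>
  consist of \<open>d\<close> vertices of smallest weight and let \<open>f\<close> be the positive part of
  \<open>u - max\<^sub>S u\<close>. Every edge containing \<open>S\<close> then leaves an \<open>m\<close>-set outside \<open>S\<close> whose
  \<open>f\<close>-weight exceeds \<open>k\<close> times the mean of \<open>f\<close>. So the degree of \<open>S\<close> is controlled by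
  \<open>P(X\<^sub>1 + \<dots> + X\<^sub>m \<ge> m + 1)\<close> for independent, identically distributed \<open>X\<^sub>i \<ge> 0\<close> of
  mean at most \<open>(m + 1) / k \<le> 1\<close>. The extremal graphs for the lower bound consist of all
  \<open>k\<close>-sets that meet a fixed set of slightly fewer than \<open>n / k\<close> vertices.

  The sharp estimate \<open>P(X\<^sub>1 + \<dots> + X\<^sub>m < m + 1) \<ge> (m / (m + 1))^m\<close> for mean one (the
  identically distributed case of a conjecture of Samuels) is obtained for \<open>m \<le> 4\<close> from a
  dual certificate: a symmetric function \<open>h\<close> of \<open>m - 1\<close> variables such that
  \<open>\<Sum>\<^sub>i (X\<^sub>i - 1) h(X\<^sub>1, \<dots>, X\<^sub>i\<^sub>-\<^sub>1, X\<^sub>i\<^sub>+\<^sub>1, \<dots>, X\<^sub>m)\<close> is pointwise at least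
  \<open>A - B 1[X\<^sub>1 + \<dots> + X\<^sub>m < m + 1]\<close> on \<open>[0, m + 1]\<close>, where \<open>A / B = (m / (m + 1))^m\<close>.
  The sum on the left has expectation zero.
\<close>

section \<open>Graphs without a perfect fractional matching\<close>

lemma farkas:
  fixes a :: "'e \<Rightarrow> 'v \<Rightarrow> real"
  assumes "finite V" "finite E"
    and "\<And>u. (\<And>e. e \<in> E \<Longrightarrow> 0 \<le> (\<Sum>v\<in>V. a e v * u v)) \<Longrightarrow> 0 \<le> (\<Sum>v\<in>V. b v * u v)"
  shows "\<exists>w. (\<forall>e\<in>E. 0 \<le> w e) \<and> (\<forall>v\<in>V. b v = (\<Sum>e\<in>E. w e * a e v))"
  using assms(2,3)
proof (induction E arbitrary: a b rule: finite_induct)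
  case empty
  have "b v = 0" if "v \<in> V" for v
  proof -
    \<comment> \<open>Without rows every \<open>u\<close> is admissible; testing with
      \<open>- b v\<close> at \<open>v\<close> alone gives \<open>- (b v)^2\<close>.\<close>
    have "0 \<le> (\<Sum>v'\<in>V. b v' * (if v' = v then - b v else 0))"
      by (rule empty) simp
    also have "\<dots> = - (b v * b v)"
      using that \<open>finite V\<close> by (simp add: if_distrib [where f = "\<lambda>x. _ * x"] cong: if_cong)
    finally show ?thesis by (auto simp: mult_le_0_iff)
  qed
  then show ?case by simp
next
  case (insert n E)
  let ?dot = "\<lambda>a u. \<Sum>v\<in>V. a v * u v"
  show ?case
  proof (cases "\<forall>u. (\<forall>e\<in>E. 0 \<le> ?dot (a e) u) \<longrightarrow> 0 \<le> ?dot b u")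
    case True
    with insert.IH [of a b] obtain w
      where w: "\<forall>e\<in>E. 0 \<le> w e" "\<forall>v\<in>V. b v = (\<Sum>e\<in>E. w e * a e v)" by blast
    have "(\<Sum>e\<in>insert n E. (w(n := 0)) e * a e v) = (\<Sum>e\<in>E. w e * a e v)" for v
      using insert.hyps by (auto intro!: sum.cong)
    with w show ?thesis by (intro exI [of _ "w(n := 0)"]) auto
  next
    case False
    then obtain u0 where u0: "\<And>e. e \<in> E \<Longrightarrow> 0 \<le> ?dot (a e) u0" "?dot b u0 < 0" by force
    have neg: "?dot (a n) u0 < 0"
      using insert.prems [of u0] u0 by force
    define c where "c = - ?dot (a n) u0"
    have c: "c > 0" using neg by (simp add: c_def)
    \<comment> \<open>The multiple of \<open>u0\<close> is the one that cancels
      \<open>?dot (a n) u\<close>, since \<open>?dot (a n) u0 = - c\<close>. By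
      \<open>dot_proj\<close> the projection can be moved from \<open>u\<close> to the rows and to
      \<open>b\<close>.\<close>
    define proj where "proj u = (\<lambda>v. u v + ?dot (a n) u / c * u0 v)" for u
    have lin1: "?dot f (\<lambda>v. u v + r * u' v) = ?dot f u + r * ?dot f u'"
      and lin2: "?dot (\<lambda>v. f v + r * f' v) u = ?dot f u + r * ?dot f' u" for f f' u u' and r :: real
      by (simp_all add: ring_distribs sum.distrib sum_distrib_left mult_ac)
    have dot_proj: "?dot f (proj u) = ?dot (\<lambda>v. f v + ?dot f u0 / c * a n v) u" for f u
      unfolding proj_def lin1 lin2 by simp
    have proj_n: "?dot (a n) (proj u) = 0" for u
      unfolding proj_def lin1 using c by (simp add: c_def)
    let ?a = "\<lambda>e v. a e v + ?dot (a e) u0 / c * a n v"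
    let ?b = "\<lambda>v. b v + ?dot b u0 / c * a n v"
    have "\<exists>w. (\<forall>e\<in>E. 0 \<le> w e) \<and> (\<forall>v\<in>V. ?b v = (\<Sum>e\<in>E. w e * ?a e v))"
    proof (rule insert.IH)
      fix u assume u: "\<And>e. e \<in> E \<Longrightarrow> 0 \<le> ?dot (?a e) u"
      show "0 \<le> ?dot ?b u"
        unfolding dot_proj [symmetric]
      proof (rule insert.prems)
        fix e assume "e \<in> insert n E"
        then show "0 \<le> ?dot (a e) (proj u)"
          using u [of e] by (cases "e = n") (simp add: proj_n, simp add: dot_proj)
      qed
    qed
    then obtain w
      where ww: "(\<forall>e\<in>E. 0 \<le> w e) \<and> (\<forall>v\<in>V. ?b v = (\<Sum>e\<in>E. w e * ?a e v))" ..
    note w = conjunct1 [OF ww] conjunct2 [OF ww]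
    \<comment> \<open>The coefficient of \<open>a n\<close> left over when \<open>?a\<close> and
      \<open>?b\<close> are expanded. It is nonnegative because \<open>u0\<close> is nonnegative on
      the rows of \<open>E\<close> and negative on \<open>b\<close>.\<close>
    define wn where "wn = (\<Sum>e\<in>E. w e * (?dot (a e) u0 / c)) - ?dot b u0 / c"
    have "0 \<le> (\<Sum>e\<in>E. w e * (?dot (a e) u0 / c))"
      using w(1) u0(1) c by (simp add: sum_nonneg)
    moreover have "?dot b u0 / c < 0"
      using u0(2) c by (rule divide_neg_pos)
    ultimately have "0 \<le> wn"
      by (simp add: wn_def)
    moreover have "b v = (\<Sum>e\<in>insert n E. (w(n := wn)) e * a e v)" if "v \<in> V" for v
    proof -
      have "(\<Sum>e\<in>insert n E. (w(n := wn)) e * a e v) = wn * a n v + (\<Sum>e\<in>E. w e * a e v)"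
      proof -
        have "(\<Sum>e\<in>E. (w(n := wn)) e * a e v) = (\<Sum>e\<in>E. w e * a e v)"
          using insert.hyps by (intro sum.cong) auto
        with insert.hyps show ?thesis by simp
      qed
      moreover have "?b v = (\<Sum>e\<in>E. w e * a e v) + (\<Sum>e\<in>E. w e * (?dot (a e) u0 / c)) * a n v"
      proof -
        have "(\<Sum>e\<in>E. w e * (a e v + r e * a n v))
            = (\<Sum>e\<in>E. w e * a e v) + (\<Sum>e\<in>E. w e * r e) * a n v" for r :: "'e \<Rightarrow> real"
          by (simp add: ring_distribs sum.distrib sum_distrib_right mult.assoc)
        then show ?thesis
          using bspec [OF w(2) that] by (rule trans [rotated])
      qed
      ultimately show ?thesis by (simp add: wn_def algebra_simps)
    qed
    ultimately show ?thesis
      using w(1) by (intro exI [of _ "w(n := wn)"]) auto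
  qed
qed

section \<open>The fractional matching number as a supremum, and its dual witness\<close>

lemma fractional_matching_number_upper:
  assumes "finite E" "fractional_matching V E w"
  shows "sum w E \<le> fractional_matching_number V E"
  unfolding fractional_matching_number_def
proof (rule cSup_upper)
  show "bdd_above {\<Sum>e\<in>E. w e |w. fractional_matching V E w}"
  proof (rule bdd_aboveI)
    fix x assume "x \<in> {\<Sum>e\<in>E. w e |w. fractional_matching V E w}"
    then obtain w where "fractional_matching V E w" "x = sum w E" by blast
    \<comment> \<open>Weights at most 1 bound every size by \<open>card E\<close>, so the supremum
      is a genuine one.\<close>
    then show "x \<le> real (card E) * 1"
      using sum_bounded_above [of E w 1] by (simp add: fractional_matching_def)
  qed
qed (use assms in blast)

lemma fractional_matching_number_least:
  assumes "\<And>w. fractional_matching V E w \<Longrightarrow> sum w E \<le> x"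
  shows "fractional_matching_number V E \<le> x"
  unfolding fractional_matching_number_def
proof (rule cSup_least)
  have "fractional_matching V E (\<lambda>_. 0)" by (simp add: fractional_matching_def)
  then show "{\<Sum>e\<in>E. w e |w. fractional_matching V E w} \<noteq> {}" by blast
qed (use assms in blast)

text \<open>Farkas for the incidence vectors of the edges and the all-one vector: a nonnegative
  combination of edges equal to the all-one vector would be a fractional matching saturating every
  vertex, and counting incidences gives it size \<open>card V / k\<close>.\<close>

lemma no_perfect_fractional_matching:
  fixes V :: "'v set"
  assumes H: "k_graph k V E" and k: "0 < k"
    and less: "fractional_matching_number V E < real (card V) / real k"
  obtains u :: "'v \<Rightarrow> real" where "\<And>e. e \<in> E \<Longrightarrow> 0 \<le> sum u e" "sum u V < 0"
proof (rule ccontr)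
  assume "\<not> thesis"
  note witness = that
  have contra: "0 \<le> sum u V" if u: "\<And>e. e \<in> E \<Longrightarrow> 0 \<le> sum u e" for u :: "'v \<Rightarrow> real"
  proof (rule ccontr)
    assume "\<not> 0 \<le> sum u V"
    then have thesis by (intro witness [of u]) (simp_all add: u)
    with \<open>\<not> thesis\<close> show False ..
  qed
  have fin: "finite V" and E: "\<And>e. e \<in> E \<Longrightarrow> e \<subseteq> V \<and> card e = k"
    using H by (auto simp: k_graph_def)
  have finE: "finite E"
    by (rule finite_subset [of _ "Pow V"]) (use fin E in auto)
  have sum_ind: "(\<Sum>v\<in>V. of_bool (v \<in> e) * u v) = sum u e" if "e \<in> E" for e and u :: "'v \<Rightarrow> real"
    using fin E [OF that] by (simp add: of_bool_def if_distrib [where f = "\<lambda>x. x * _"]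
        sum.If_cases Int_absorb1 cong: if_cong)
  have "\<exists>w :: 'v set \<Rightarrow> real. (\<forall>e\<in>E. 0 \<le> w e) \<and> (\<forall>v\<in>V. 1 = (\<Sum>e\<in>E. w e * of_bool (v \<in> e)))"
  proof (rule farkas [OF fin finE, where a = "\<lambda>e v. of_bool (v \<in> e)" and b = "\<lambda>_. 1"])
    fix u :: "'v \<Rightarrow> real"
    assume "\<And>e. e \<in> E \<Longrightarrow> 0 \<le> (\<Sum>v\<in>V. of_bool (v \<in> e) * u v)"
    then have "\<And>e. e \<in> E \<Longrightarrow> 0 \<le> sum u e" by (simp add: sum_ind)
    then show "0 \<le> (\<Sum>v\<in>V. 1 * u v)" by (simp add: contra)
  qed
  then obtain w :: "'v set \<Rightarrow> real" where w: "\<And>e. e \<in> E \<Longrightarrow> 0 \<le> w e"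
    and one: "\<And>v. v \<in> V \<Longrightarrow> 1 = (\<Sum>e\<in>E. w e * of_bool (v \<in> e))"
    by blast
  have "fractional_matching V E w"
    unfolding fractional_matching_def
  proof (intro conjI ballI)
    fix v assume "v \<in> V"
    have "(\<Sum>e\<in>{e \<in> E. v \<in> e}. w e) = (\<Sum>e\<in>E. w e * of_bool (v \<in> e))"
      using finE by (intro sum.mono_neutral_cong_left) auto
    with one [OF \<open>v \<in> V\<close>] show "(\<Sum>e\<in>{e \<in> E. v \<in> e}. w e) \<le> 1" by simp
  next
    fix e assume "e \<in> E"
    then show "0 \<le> w e" by (rule w)
    \<comment> \<open>The bound \<open>w e \<le> 1\<close> comes from a vertex of \<open>e\<close>,
      which exists as \<open>0 < k\<close>: the weights of the edges at it sum to 1.\<close>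
    obtain v where "v \<in> e" "v \<in> V"
      using E [OF \<open>e \<in> E\<close>] k by (metis card.empty equals0I not_gr_zero subsetD)
    have "w e * of_bool (v \<in> e) \<le> (\<Sum>e\<in>E. w e * of_bool (v \<in> e))"
      using w by (intro member_le_sum \<open>e \<in> E\<close> finE) simp
    with one [OF \<open>v \<in> V\<close>] \<open>v \<in> e\<close> show "w e \<le> 1" by simp
  qed
  then have "sum w E < real (card V) / real k"
    using fractional_matching_number_upper [OF finE] less by fastforce
  moreover have "real k * sum w E = real (card V)"
  proof -
    have "real (card V) = (\<Sum>v\<in>V. \<Sum>e\<in>E. w e * of_bool (v \<in> e))"
      using one by simp
    also have "\<dots> = (\<Sum>e\<in>E. \<Sum>v\<in>V. of_bool (v \<in> e) * w e)"
      by (subst sum.swap) (simp add: mult.commute)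
    also have "\<dots> = (\<Sum>e\<in>E. real k * w e)"
      by (intro sum.cong refl) (use sum_ind E in \<open>simp add: sum_ind [of _ "\<lambda>_. w _"]\<close>)
    finally show ?thesis by (simp add: sum_distrib_left)
  qed
  ultimately show False using k by (simp add: field_simps)
qed

section \<open>Dual certificates for the tail bound\<close>

text \<open>
  The certificate \<open>h\<close> for \<open>m\<close> variables is given by \<open>lo\<close> where its arguments sum to less
  than \<open>m\<close> and by \<open>hi\<close> elsewhere. For \<open>m = 3\<close> the arguments of \<open>lo\<close> and \<open>hi\<close> are the
  maximum and the minimum; for \<open>m = 4\<close> they are the maximum and the sum and the product of the
  two others. The values of \<open>h\<close> at the points with all coordinates in \<open>{0, m + 1}\<close> are forced,
  because the \<open>X\<^sub>i\<close> supported on these two values are extremal; the other coefficients come from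
  linear programming.
\<close>

definition lo2 :: "real \<Rightarrow> real" where
  "lo2 a = 5 + 3 * a"

definition hi2 :: "real \<Rightarrow> real" where
  "hi2 a = 11 - 3 * a"

definition lo3 :: "real \<Rightarrow> real \<Rightarrow> real" where
  "lo3 a b = 37 * ((1 + a) * (1 + b) + 1)"

definition hi3 :: "real \<Rightarrow> real \<Rightarrow> real" where
  "hi3 a b = 30 - 3 * b + (4 - a) * (14 + 8 * (4 - a))"

definition lo4 :: "real \<Rightarrow> real \<Rightarrow> real \<Rightarrow> real" where
  "lo4 a p q = 369 * ((1 + a) * (1 + p) + 2) + 120 * q"

definition hi4 :: "real \<Rightarrow> real \<Rightarrow> real \<Rightarrow> real" where
  "hi4 a p q = 452 - 36 * p + 4 * q + (5 - a) * (156 + 106 * (5 - a) - 4 * p)"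

text \<open>
  For \<open>a \<ge> b \<ge> c \<ge> d\<close> the number in the lemma names is the number of variables whose removal
  leaves a sum of at least \<open>m\<close>; \<open>lt\<close> and \<open>ge\<close> compare the full sum to \<open>m + 1\<close>. In each
  case the difference of the two sides is a polynomial with nonnegative coefficients in the slacks
  of the linear constraints.
\<close>

lemma dual2_lt_0:
  fixes a b :: real
  assumes "b \<le> a" "0 \<le> b"
  shows "- 10 \<le> (a - 1) * lo2 b
     + (b - 1) * lo2 a"
    (is "_ \<le> ?L")
proof -
  define x y where slack: "x = a - b" "y = b"
  have nonneg: "0 \<le> x" "0 \<le> y"
    using assms by (simp_all add: slack)
  have "?L + 10 = 6*x*y + 2*x + 6*y^2 + 4*y"
    unfolding slack lo2_def by algebra
  also have "\<dots> \<ge> 0"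
    using nonneg by (intro add_nonneg_nonneg mult_nonneg_nonneg zero_le_power) simp_all
  finally show ?thesis by simp
qed

lemma dual2_lt_1:
  fixes a b :: real
  assumes "0 \<le> b" "2 \<le> a"
  shows "- 10 \<le> (a - 1) * lo2 b
     + (b - 1) * hi2 a"
    (is "_ \<le> ?L")
proof -
  define y g where slack: "y = b" "g = a - 2"
  have nonneg: "0 \<le> y" "0 \<le> g"
    using assms by (simp_all add: slack)
  have "?L + 10 = 8*g + 8*y + 10"
    unfolding slack lo2_def hi2_def by algebra
  also have "\<dots> \<ge> 0"
    using nonneg by (intro add_nonneg_nonneg mult_nonneg_nonneg zero_le_power) simp_all
  finally show ?thesis by simp
qed

lemma dual2_ge_0:
  fixes a b :: real
  assumes "b \<le> a" "3 \<le> a + b" "a \<le> 2"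
  shows "8 \<le> (a - 1) * lo2 b
     + (b - 1) * lo2 a"
    (is "_ \<le> ?L")
proof -
  define x s l where slack: "x = a - b" "s = a + b - 3" "l = 2 - a"
  have nonneg: "0 \<le> x" "0 \<le> s" "0 \<le> l"
    using assms by (simp_all add: slack)
  have "?L - 8 = 5*l*x + 10*s*x + 4*l^2 + 19*l*s + l + 10*s^2 + 4*s"
    unfolding slack lo2_def by algebra
  also have "\<dots> \<ge> 0"
    using nonneg by (intro add_nonneg_nonneg mult_nonneg_nonneg zero_le_power) simp_all
  finally show ?thesis by simp
qed

lemma dual2_ge_1:
  fixes a b :: real
  assumes "0 \<le> b" "3 \<le> a + b"
  shows "8 \<le> (a - 1) * lo2 b
     + (b - 1) * hi2 a"
    (is "_ \<le> ?L")
proof -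
  define y s where slack: "y = b" "s = a + b - 3"
  have nonneg: "0 \<le> y" "0 \<le> s"
    using assms by (simp_all add: slack)
  have "?L - 8 = 8*s"
    unfolding slack lo2_def hi2_def by algebra
  also have "\<dots> \<ge> 0"
    using nonneg by (intro add_nonneg_nonneg mult_nonneg_nonneg zero_le_power) simp_all
  finally show ?thesis by simp
qed

lemma dual2_ge_2:
  fixes a b :: real
  assumes "b \<le> a" "a \<le> 3" "3 \<le> a + b" "2 \<le> b"
  shows "8 \<le> (a - 1) * hi2 b
     + (b - 1) * hi2 a"
    (is "_ \<le> ?L")
proof -
  define x t s g where slack: "x = a - b" "t = 3 - a" "s = a + b - 3" "g = b - 2"
  have nonneg: "0 \<le> x" "0 \<le> t" "0 \<le> s" "0 \<le> g"
    using assms by (simp_all add: slack)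
  have "?L - 8 = 2*g*t + 2*s*t + 2*g*x + 2*x^2 + 2*x"
    unfolding slack hi2_def by algebra
  also have "\<dots> \<ge> 0"
    using nonneg by (intro add_nonneg_nonneg mult_nonneg_nonneg zero_le_power) simp_all
  finally show ?thesis by simp
qed

lemma dual3_lt_0:
  fixes a b c :: real
  assumes "b \<le> a" "c \<le> b" "0 \<le> c"
  shows "- 222 \<le> (a - 1) * lo3 b c
     + (b - 1) * lo3 a c
     + (c - 1) * lo3 a b"
    (is "_ \<le> ?L")
proof -
  define x y z where slack: "x = a - b" "y = b - c" "z = c"
  have nonneg: "0 \<le> x" "0 \<le> y" "0 \<le> z"
    using assms by (simp_all add: slack)
  have "?L + 222 = 111*x*y*z + 37*x*y + 111*x*z^2 + 74*x*z + 111*y^2*z + 37*y^2 + 222*y*z^2 + 148*y*z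
       + 111*z^3 + 111*z^2"
    unfolding slack lo3_def by algebra
  also have "\<dots> \<ge> 0"
    using nonneg by (intro add_nonneg_nonneg mult_nonneg_nonneg zero_le_power) simp_all
  finally show ?thesis by simp
qed

lemma dual3_lt_1:
  fixes a b c :: real
  assumes "b \<le> a" "c \<le> b" "0 \<le> c" "a \<le> 4" "a + b + c \<le> 4" "3 \<le> a + b"
  shows "- 222 \<le> (a - 1) * lo3 b c
     + (b - 1) * lo3 a c
     + (c - 1) * hi3 a b"
    (is "_ \<le> ?L")
proof -
  define x y z t s g where slack: "x = a - b" "y = b - c" "z = c" "t = 4 - a"
    "s = 4 - (a + b + c)" "g = a + b - 3"
  have nonneg: "0 \<le> x" "0 \<le> y" "0 \<le> z" "0 \<le> t" "0 \<le> s" "0 \<le> g"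
    using assms by (simp_all add: slack)
  have "?L + 222 = g^2*s + 23/6*g*t^2 + 20/7*g*s*x + 1/42*x^3 + 44/21*x^2*y + 293/21*x^2*z + 25/6*x^2
       + 179/42*x*y^2 + 2273/21*x*y*z + 93*x*y + 4367/42*x*z^2 + 3/7*x*z + 608/21*x
       + 1/3*y^3 + 87*y^2*z + 593/6*y^2 + 173*y*z^2 + 314/3*y*z + 19/3*y + 259/3*z^3
       + 35/6*z^2 + 466/3*z + 8"
    unfolding slack lo3_def hi3_def by algebra
  also have "\<dots> \<ge> 0"
    using nonneg by (intro add_nonneg_nonneg mult_nonneg_nonneg zero_le_power) simp_all
  finally show ?thesis by simp
qed

lemma dual3_lt_2:
  fixes a b c :: real
  assumes "b \<le> a" "c \<le> b" "0 \<le> c" "a \<le> 4" "3 \<le> a + c" "b + c \<le> 3"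
  shows "- 222 \<le> (a - 1) * lo3 b c
     + (b - 1) * hi3 a c
     + (c - 1) * hi3 a b"
    (is "_ \<le> ?L")
proof -
  define x y z t g l where slack: "x = a - b" "y = b - c" "z = c" "t = 4 - a" "g = a + c - 3"
    "l = 3 - (b + c)"
  have nonneg: "0 \<le> x" "0 \<le> y" "0 \<le> z" "0 \<le> t" "0 \<le> g" "0 \<le> l"
    using assms by (simp_all add: slack)
  have "?L + 222 = 87/11*l*g*t + 1/11*x^2*y + 2/11*x^2*z + 85/11*x^2 + 2/11*x*y^2 + 326/11*x*y*z
       + 328/11*x*y + 237/11*x*z^2 + 747/11*x*z + 703/11*x + 1/11*y^3 + 324/11*y^2*z
       + 243/11*y^2 + 558/11*y*z^2 + 780/11*y*z + 149*y + 235/11*z^3 + 885/11*z^2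
       + 1531/11*z + 52/11"
    unfolding slack lo3_def hi3_def by algebra
  also have "\<dots> \<ge> 0"
    using nonneg by (intro add_nonneg_nonneg mult_nonneg_nonneg zero_le_power) simp_all
  finally show ?thesis by simp
qed

lemma dual3_ge_0:
  fixes a b c :: real
  assumes "b \<le> a" "c \<le> b" "0 \<le> c" "a \<le> 4" "4 \<le> a + b + c" "a + b \<le> 3"
  shows "162 \<le> (a - 1) * lo3 b c
     + (b - 1) * lo3 a c
     + (c - 1) * lo3 a b"
    (is "_ \<le> ?L")
proof -
  define x y z t s l where slack: "x = a - b" "y = b - c" "z = c" "t = 4 - a" "s = a + b + c - 4"
    "l = 3 - (a + b)"
  have nonneg: "0 \<le> x" "0 \<le> y" "0 \<le> z" "0 \<le> t" "0 \<le> s" "0 \<le> l"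
    using assms by (simp_all add: slack)
  have "?L - 162 = 2*x*t^2 + 20*x^2*y + 50*x*y*t + 20*l*x^2 + 100*l*x*t + 100*s*x*t + 100*s*x*z
       + 222*l^3 + 845*l^2*s + 287*l^2*y + 227*l^2 + 898*l*s^2 + 739*l*s*y + 658*l*s
       + 141*l*y^2 + 415*l*y + 84*l + 293*s^3 + 410*s^2*y + 377*s^2 + 141*s*y^2 + 573*s*y
       + 189*s + 24*y^3 + 96*y^2 + 36*y + 15"
    unfolding slack lo3_def by algebra
  also have "\<dots> \<ge> 0"
    using nonneg by (intro add_nonneg_nonneg mult_nonneg_nonneg zero_le_power) simp_all
  finally show ?thesis by simp
qed

lemma dual3_ge_1:
  fixes a b c :: real
  assumes "b \<le> a" "0 \<le> c" "a \<le> 4" "4 \<le> a + b + c" "3 \<le> a + b" "a + c \<le> 3"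
  shows "162 \<le> (a - 1) * lo3 b c
     + (b - 1) * lo3 a c
     + (c - 1) * hi3 a b"
    (is "_ \<le> ?L")
proof -
  define x z t s g l where slack: "x = a - b" "z = c" "t = 4 - a" "s = a + b + c - 4"
    "g = a + b - 3" "l = 3 - (a + c)"
  have nonneg: "0 \<le> x" "0 \<le> z" "0 \<le> t" "0 \<le> s" "0 \<le> g" "0 \<le> l"
    using assms by (simp_all add: slack)
  have "?L - 162 = 14*l*x^2 + 21/2*s*x^2 + 35/2*s^2*x + 641/20*l*x*t + 121/2*s*x*t + 29*s*t^2 + g*s*x
       + 206/5*g*s*t + 81/10*l^3 + 521/20*l^2*g + 1/5*l^2*z + 79/20*l^2 + 3/10*l*g^2
       + 1027/20*l*g*z + 1/4*l*g + 111/10*l*z^2 + 1169/20*l*z + 7/20*l + 8*g^3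
       + 199/5*g^2*z + 13/10*g^2 + 214/5*g*z^2 + 85/2*g*z + 1/5*g + 19*z^3 + 2*z^2
       + 1/2*z + 3/2"
    unfolding slack lo3_def hi3_def by algebra
  also have "\<dots> \<ge> 0"
    using nonneg by (intro add_nonneg_nonneg mult_nonneg_nonneg zero_le_power) simp_all
  finally show ?thesis by simp
qed

lemma dual3_ge_2:
  fixes a b c :: real
  assumes "b \<le> a" "c \<le> b" "0 \<le> c" "a \<le> 4" "4 \<le> a + b + c" "3 \<le> a + c"
    "b + c \<le> 3"
  shows "162 \<le> (a - 1) * lo3 b c
     + (b - 1) * hi3 a c
     + (c - 1) * hi3 a b"
    (is "_ \<le> ?L")
proof -
  define x y z t s g l where slack: "x = a - b" "y = b - c" "z = c" "t = 4 - a"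
    "s = a + b + c - 4" "g = a + c - 3" "l = 3 - (b + c)"
  have nonneg: "0 \<le> x" "0 \<le> y" "0 \<le> z" "0 \<le> t" "0 \<le> s" "0 \<le> g" "0 \<le> l"
    using assms by (simp_all add: slack)
  have "?L - 162 = 51/8*s*x^2 + 7*l*s^2 + 2*s*x*y + 6*l*s*y + 16*s*x*t + 8*l*s*t + 77/8*s*t^2
       + 7/4*g^2*y + 43/4*g^2*z + 19/8*g*y^2 + 45*g*y*z + 79/2*g*y + 213/8*g*z^2
       + 131/2*g*z + 69/8*y^3 + 353/8*y^2*z + 13/8*y^2 + 267/8*y*z^2 + 34*y*z + 3/4*y
       + 47/8*z^3 + 75/8*z^2 + 31/4*z"
    unfolding slack lo3_def hi3_def by algebra
  also have "\<dots> \<ge> 0"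
    using nonneg by (intro add_nonneg_nonneg mult_nonneg_nonneg zero_le_power) simp_all
  finally show ?thesis by simp
qed

lemma dual3_ge_3:
  fixes a b c :: real
  assumes "b \<le> a" "c \<le> b" "0 \<le> c" "a \<le> 4" "4 \<le> a + b + c" "3 \<le> b + c"
  shows "162 \<le> (a - 1) * hi3 b c
     + (b - 1) * hi3 a c
     + (c - 1) * hi3 a b"
    (is "_ \<le> ?L")
proof -
  define x y z t s g where slack: "x = a - b" "y = b - c" "z = c" "t = 4 - a" "s = a + b + c - 4"
    "g = b + c - 3"
  have nonneg: "0 \<le> x" "0 \<le> y" "0 \<le> z" "0 \<le> t" "0 \<le> s" "0 \<le> g"
    using assms by (simp_all add: slack)
  have "?L - 162 = 1/20*s*y*t + 7/2*y*z*t + 4/7*y*t^2 + 5/6*x*y*z + 5/6*g^2*x + 71/20*g^2*t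
       + 5/2*g*x^2 + 131/10*g*x*t + g*x + 2677/140*g*t^2 + 19/10*g*t + 5/3*x^3
       + 7/3*x^2*t + 145/6*x^2 + 149/210*x*t^2 + 569/30*x*t + 43/6*x + 3/70*t^3
       + 27/140*t^2 + 3/4*t"
    unfolding slack hi3_def by algebra
  also have "\<dots> \<ge> 0"
    using nonneg by (intro add_nonneg_nonneg mult_nonneg_nonneg zero_le_power) simp_all
  finally show ?thesis by simp
qed

lemma dual4_lt_0:
  fixes a b c d :: real
  assumes "b \<le> a" "c \<le> b" "d \<le> c" "0 \<le> d"
  shows "- 4428 \<le> (a - 1) * lo4 b (c + d) (c * d)
     + (b - 1) * lo4 a (c + d) (c * d)
     + (c - 1) * lo4 a (b + d) (b * d)
     + (d - 1) * lo4 a (b + c) (b * c)"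
    (is "_ \<le> ?L")
proof -
  define x y z w where slack: "x = a - b" "y = b - c" "z = c - d" "w = d"
  have nonneg: "0 \<le> x" "0 \<le> y" "0 \<le> z" "0 \<le> w"
    using assms by (simp_all add: slack)
  have "?L + 4428 = 1107*x*y*z + 2214*x*y*w + 1107*x*z^2 + 4179*x*z*w + 3072*x*w^2 + 1107*y^2*z
       + 2214*y^2*w + 2214*y*z^2 + 7860*y*z*w + 249*y*z + 5646*y*w^2 + 498*y*w + 1107*z^3
       + 5646*z^2*w + 249*z^2 + 7971*z*w^2 + 1245*z*w + 3432*w^3 + 996*w^2"
    unfolding slack lo4_def by algebra
  also have "\<dots> \<ge> 0"
    using nonneg by (intro add_nonneg_nonneg mult_nonneg_nonneg zero_le_power) simp_all
  finally show ?thesis by simp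
qed

lemma dual4_lt_1:
  fixes a b c d :: real
  assumes "b \<le> a" "c \<le> b" "d \<le> c" "0 \<le> d" "a \<le> 5" "a + b + c + d \<le> 5"
    "4 \<le> a + b + c" "a + b + d \<le> 4"
  shows "- 4428 \<le> (a - 1) * lo4 b (c + d) (c * d)
     + (b - 1) * lo4 a (c + d) (c * d)
     + (c - 1) * lo4 a (b + d) (b * d)
     + (d - 1) * hi4 a (b + c) (b * c)"
    (is "_ \<le> ?L")
proof -
  define x y z w t s g l where slack: "x = a - b" "y = b - c" "z = c - d" "w = d" "t = 5 - a"
    "s = 5 - (a + b + c + d)" "g = a + b + c - 4" "l = 4 - (a + b + d)"
  have nonneg: "0 \<le> x" "0 \<le> y" "0 \<le> z" "0 \<le> w" "0 \<le> t" "0 \<le> s" "0 \<le> g"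
    "0 \<le> l"
    using assms by (simp_all add: slack)
  have "?L + 4428 = 20*l*g^2 + 42*g*t^2 + 20*g*x*t + 5*l*g*x + 2*s*x^2 + 50*w*t^2 + 60*s^2*w + 5*x^3
       + 36*x^2*y + 61*x^2*z + 84*x^2*w + 12*x^2 + 90*x*y^2 + 1393*x*y*z + 2097*x*y*w
       + 429*x*y + 1323*x*z^2 + 3768*x*z*w + 774*x*z + 2325*x*w^2 + 109*x*w + 295*x
       + 76*y^3 + 1453*y^2*z + 2091*y^2*w + 307*y^2 + 2718*y*z^2 + 7289*y*z*w + 1124*y*z
       + 4331*y*w^2 + 743*y*w + 150*y + 1341*z^3 + 5198*z^2*w + 737*z^2 + 6013*z*w^2
       + 1606*z*w + 165*z + 2096*w^3 + 1469*w^2 + 510*w + 145"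
    unfolding slack lo4_def hi4_def by algebra
  also have "\<dots> \<ge> 0"
    using nonneg by (intro add_nonneg_nonneg mult_nonneg_nonneg zero_le_power) simp_all
  finally show ?thesis by simp
qed

lemma dual4_lt_2:
  fixes a b c d :: real
  assumes "b \<le> a" "c \<le> b" "d \<le> c" "0 \<le> d" "a \<le> 5" "a + b + c + d \<le> 5"
    "4 \<le> a + b + d" "a + c + d \<le> 4"
  shows "- 4428 \<le> (a - 1) * lo4 b (c + d) (c * d)
     + (b - 1) * lo4 a (c + d) (c * d)
     + (c - 1) * hi4 a (b + d) (b * d)
     + (d - 1) * hi4 a (b + c) (b * c)"
    (is "_ \<le> ?L")
proof -
  define x y z w t s g l where slack: "x = a - b" "y = b - c" "z = c - d" "w = d" "t = 5 - a"
    "s = 5 - (a + b + c + d)" "g = a + b + d - 4" "l = 4 - (a + c + d)"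
  have nonneg: "0 \<le> x" "0 \<le> y" "0 \<le> z" "0 \<le> w" "0 \<le> t" "0 \<le> s" "0 \<le> g"
    "0 \<le> l"
    using assms by (simp_all add: slack)
  have "?L + 4428 = 20*g*t^2 + 50*l*g*t + 55*g*s*x + 30*s*x^2 + 100*g*s*y + 15*x^3 + 100*x^2*y
       + 141*x^2*z + 267*x^2*w + 73*x^2 + 270*x*y^2 + 1154*x*y*z + 2238*x*y*w + 926*x*y
       + 784*x*z^2 + 2585*x*z*w + 836*x*z + 1806*x*w^2 + 221*x*w + 170*x + 260*y^3
       + 1328*y^2*z + 2406*y^2*w + 298*y^2 + 1676*y*z^2 + 5414*y*z*w + 1416*y*z
       + 3788*y*w^2 + 586*y*w + 420*y + 608*z^3 + 2708*z^2*w + 1518*z^2 + 3542*z*w^2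
       + 3004*z*w + 620*z + 1442*w^3 + 1736*w^2 + 1320*w + 450"
    unfolding slack lo4_def hi4_def by algebra
  also have "\<dots> \<ge> 0"
    using nonneg by (intro add_nonneg_nonneg mult_nonneg_nonneg zero_le_power) simp_all
  finally show ?thesis by simp
qed

lemma dual4_lt_3:
  fixes a b c d :: real
  assumes "b \<le> a" "c \<le> b" "d \<le> c" "0 \<le> d" "a \<le> 5" "4 \<le> a + c + d"
    "b + c + d \<le> 4"
  shows "- 4428 \<le> (a - 1) * lo4 b (c + d) (c * d)
     + (b - 1) * hi4 a (c + d) (c * d)
     + (c - 1) * hi4 a (b + d) (b * d)
     + (d - 1) * hi4 a (b + c) (b * c)"
    (is "_ \<le> ?L")
proof -
  define x y z w t g l where slack: "x = a - b" "y = b - c" "z = c - d" "w = d" "t = 5 - a"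
    "g = a + c + d - 4" "l = 4 - (b + c + d)"
  have nonneg: "0 \<le> x" "0 \<le> y" "0 \<le> z" "0 \<le> w" "0 \<le> t" "0 \<le> g" "0 \<le> l"
    using assms by (simp_all add: slack)
  have "?L + 4428 = 105*l*g*t + x^2*y + 2*x^2*z + 3*x^2*w + 102*x^2 + 2*x*y^2 + 278*x*y*z + 552*x*y*w
       + 294*x*y + 171*x*z^2 + 534*x*z*w + 804*x*z + 258*x*w^2 + 1314*x*w + 975*x + y^3
       + 276*y^2*z + 549*y^2*w + 192*y^2 + 444*y*z^2 + 1364*y*z*w + 934*y*z + 815*y*w^2
       + 1484*y*w + 2500*y + 169*z^3 + 710*z^2*w + 1267*z^2 + 808*z*w^2 + 3898*z*w
       + 1925*z + 267*w^3 + 3156*w^2 + 1350*w + 75"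
    unfolding slack lo4_def hi4_def by algebra
  also have "\<dots> \<ge> 0"
    using nonneg by (intro add_nonneg_nonneg mult_nonneg_nonneg zero_le_power) simp_all
  finally show ?thesis by simp
qed

lemma dual4_ge_0:
  fixes a b c d :: real
  assumes "b \<le> a" "c \<le> b" "d \<le> c" "a \<le> 5" "5 \<le> a + b + c + d"
    "a + b + c \<le> 4"
  shows "3072 \<le> (a - 1) * lo4 b (c + d) (c * d)
     + (b - 1) * lo4 a (c + d) (c * d)
     + (c - 1) * lo4 a (b + d) (b * d)
     + (d - 1) * lo4 a (b + c) (b * c)"
    (is "_ \<le> ?L")
proof -
  define x y z t s l where slack: "x = a - b" "y = b - c" "z = c - d" "t = 5 - a"
    "s = a + b + c + d - 5" "l = 4 - (a + b + c)"
  have nonneg: "0 \<le> x" "0 \<le> y" "0 \<le> z" "0 \<le> t" "0 \<le> s" "0 \<le> l"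
    using assms by (simp_all add: slack)
  have "?L - 3072 = 600*x*y*t + 1000*x*z*t + 1500*l*x*t + 2000*s*x*t + 9144*l^3 + 26004*l^2*s
       + 12846*l^2*y + 19539*l^2*z + 3288*l^2 + 22576*l*s^2 + 24206*l*s*y + 37257*l*s*z
       + 14220*l*s + 6786*l*y^2 + 19132*l*y*z + 5760*l*y + 14681*l*z^2 + 5718*l*z
       + 1644*l + 6216*s^3 + 10460*s^2*y + 16218*s^2*z + 9932*s^2 + 5986*s*y^2
       + 17739*s*y*z + 9274*s*y + 13788*s*z^2 + 11397*s*z + 3216*s + 1200*y^3
       + 5093*y^2*z + 786*y^2 + 7279*y*z^2 + 3416*y*z + 414*y + 3786*z^3 + 1465*z^2
       + 1179*z"
    unfolding slack lo4_def by algebra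
  also have "\<dots> \<ge> 0"
    using nonneg by (intro add_nonneg_nonneg mult_nonneg_nonneg zero_le_power) simp_all
  finally show ?thesis by simp
qed

lemma dual4_ge_1:
  fixes a b c d :: real
  assumes "b \<le> a" "c \<le> b" "d \<le> c" "0 \<le> d" "a \<le> 5" "5 \<le> a + b + c + d"
    "4 \<le> a + b + c" "a + b + d \<le> 4"
  shows "3072 \<le> (a - 1) * lo4 b (c + d) (c * d)
     + (b - 1) * lo4 a (c + d) (c * d)
     + (c - 1) * lo4 a (b + d) (b * d)
     + (d - 1) * hi4 a (b + c) (b * c)"
    (is "_ \<le> ?L")
proof -
  define x y z w t s g l where slack: "x = a - b" "y = b - c" "z = c - d" "w = d" "t = 5 - a"
    "s = a + b + c + d - 5" "g = a + b + c - 4" "l = 4 - (a + b + d)"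
  have nonneg: "0 \<le> x" "0 \<le> y" "0 \<le> z" "0 \<le> w" "0 \<le> t" "0 \<le> s" "0 \<le> g"
    "0 \<le> l"
    using assms by (simp_all add: slack)
  have "?L - 3072 = 63*g*x^2 + 100*z*w*t + 200*g^2*w + 69*x*z*w + 600*s*x*t + 100*y*w*t + 250*y*z*w
       + 600*l*x*t + 500*x*y*w + 552*l^3 + 2141*l^2*s + 109*l^2*x + 2645*l^2*y + 1734*l^2
       + 2526*l*s^2 + 882*l*s*x + 4773*l*s*y + 3050*l*s + 129*l*x^2 + 2034*l*x*y
       + 799*l*x + 2097*l*y^2 + 1912*l*y + 1082*l + 937*s^3 + 742*s^2*x + 2278*s^2*y
       + 1716*s^2 + 97*s*x^2 + 1612*s*x*y + 168*s*x + 1645*s*y^2 + 1834*s*y + 4754*s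
       + 334*x^2*y + 820*x*y^2 + 508*x*y + 304*y^3 + 218*y^2 + 572*y"
    unfolding slack lo4_def hi4_def by algebra
  also have "\<dots> \<ge> 0"
    using nonneg by (intro add_nonneg_nonneg mult_nonneg_nonneg zero_le_power) simp_all
  finally show ?thesis by simp
qed

lemma dual4_ge_2:
  fixes a b c d :: real
  assumes "b \<le> a" "c \<le> b" "d \<le> c" "0 \<le> d" "a \<le> 5" "5 \<le> a + b + c + d"
    "a + c + d \<le> 4"
  shows "3072 \<le> (a - 1) * lo4 b (c + d) (c * d)
     + (b - 1) * lo4 a (c + d) (c * d)
     + (c - 1) * hi4 a (b + d) (b * d)
     + (d - 1) * hi4 a (b + c) (b * c)"
    (is "_ \<le> ?L")
proof -
  define x y z w t s l where slack: "x = a - b" "y = b - c" "z = c - d" "w = d" "t = 5 - a"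
    "s = a + b + c + d - 5" "l = 4 - (a + c + d)"
  have nonneg: "0 \<le> x" "0 \<le> y" "0 \<le> z" "0 \<le> w" "0 \<le> t" "0 \<le> s" "0 \<le> l"
    using assms by (simp_all add: slack)
  have "?L - 3072 = 40/3*l*t^2 + 100*l*x^2 + 1/2*x^2*y + 213*l*x*t + 491*l*x*w + 10*l*y^2 + 20*x*z*t
       + 246*l*x*z + 50*s*x^2 + 340*s*x*t + 145*s^2*x + 42*l^2*s + 90*s*x*w + 200*l*s*y
       + 200*x*y*w + 10/3*s^3 + 131/2*s^2*y + 7/3*s^2*z + 23/3*s^2*w + 43/3*s^2
       + 25*s*y^2 + 1108/3*s*y*z + 1841/3*s*y*w + 226/3*s*y + 137/3*s*z^2 + 655/3*s*z*w
       + 2354/3*s*z + 36*s*w^2 + 1033*s*w + 2193*s + 2/3*y^3 + 391/3*y^2*z + 1664/3*y^2*w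
       + 1/3*y^2 + 755/6*y*z^2 + 1595/3*y*z*w + 1597/3*y*z + 360*y*w^2 + 301*y*w + 5/2*y
       + 368/3*z^3 + 704/3*z^2*w + 118/3*z^2 + 26*z*w^2 + 336*z*w + 10*z"
    unfolding slack lo4_def hi4_def by algebra
  also have "\<dots> \<ge> 0"
    using nonneg by (intro add_nonneg_nonneg mult_nonneg_nonneg zero_le_power) simp_all
  finally show ?thesis by simp
qed

lemma dual4_ge_3:
  fixes a b c d :: real
  assumes "b \<le> a" "c \<le> b" "d \<le> c" "0 \<le> d" "a \<le> 5" "5 \<le> a + b + c + d"
    "4 \<le> a + c + d" "b + c + d \<le> 4"
  shows "3072 \<le> (a - 1) * lo4 b (c + d) (c * d)
     + (b - 1) * hi4 a (c + d) (c * d)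
     + (c - 1) * hi4 a (b + d) (b * d)
     + (d - 1) * hi4 a (b + c) (b * c)"
    (is "_ \<le> ?L")
proof -
  define x y z w t s g l where slack: "x = a - b" "y = b - c" "z = c - d" "w = d" "t = 5 - a"
    "s = a + b + c + d - 5" "g = a + c + d - 4" "l = 4 - (b + c + d)"
  have nonneg: "0 \<le> x" "0 \<le> y" "0 \<le> z" "0 \<le> w" "0 \<le> t" "0 \<le> s" "0 \<le> g"
    "0 \<le> l"
    using assms by (simp_all add: slack)
  have "?L - 3072 = 136*s*t^2 + 21*s^2*t + 14*s^3 + 90*l*s*x + 45*g*x*t + 44*l*s*y + 90*s*y^2 + s*y*t
       + 150*l*s*t + 87*s*x*t + 153*l*s^2 + 3*s^2*x + 30*s*x*z + 16*g^2*y + 174*g^2*z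
       + 393*g^2*w + 6*g*y^2 + 765*g*y*z + 1383*g*y*w + 183*g*y + 500*g*z^2 + 1391*g*z*w
       + 194*g*z + 705*g*w^2 + 207*g*w + 6*y^3 + 419*y^2*z + 624*y^2*w + y^2 + 457*y*z^2
       + 773*y*z*w + 290*y*z + 26*y*w^2 + 837*y*w + y + 150*z^3 + 294*z^2*w + 70*z^2
       + 38*z*w^2 + 362*z*w + 32*z"
    unfolding slack lo4_def hi4_def by algebra
  also have "\<dots> \<ge> 0"
    using nonneg by (intro add_nonneg_nonneg mult_nonneg_nonneg zero_le_power) simp_all
  finally show ?thesis by simp
qed

lemma dual4_ge_4:
  fixes a b c d :: real
  assumes "b \<le> a" "c \<le> b" "d \<le> c" "0 \<le> d" "a \<le> 5" "5 \<le> a + b + c + d"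
    "4 \<le> b + c + d"
  shows "3072 \<le> (a - 1) * hi4 b (c + d) (c * d)
     + (b - 1) * hi4 a (c + d) (c * d)
     + (c - 1) * hi4 a (b + d) (b * d)
     + (d - 1) * hi4 a (b + c) (b * c)"
    (is "_ \<le> ?L")
proof -
  define x y z w t s g where slack: "x = a - b" "y = b - c" "z = c - d" "w = d" "t = 5 - a"
    "s = a + b + c + d - 5" "g = b + c + d - 4"
  have nonneg: "0 \<le> x" "0 \<le> y" "0 \<le> z" "0 \<le> w" "0 \<le> t" "0 \<le> s" "0 \<le> g"
    using assms by (simp_all add: slack)
  have "?L - 3072 = 186*g*t^2 + 22*s*z*t + 14*s*w*t + 10*g*w*t + 22*y*z*t + 2*z*w*t + 24*z*t^2
       + 26*y*t^2 + 72*y*w*t + 82*s*x*t + 491/6*x*t^2 + 24*x*y*t + 1/6*x^3 + 1/3*x^2*y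
       + 7/3*x^2*z + 61/3*x^2*w + 1273/3*x^2 + 1/6*x*y^2 + 7/3*x*y*z + 61/3*x*y*w
       + 1/3*x*y + 13/6*x*z^2 + 31/3*x*z*w + 151/3*x*z + 49/6*x*w^2 + 61/3*x*w + 565/6*x"
    unfolding slack hi4_def by algebra
  also have "\<dots> \<ge> 0"
    using nonneg by (intro add_nonneg_nonneg mult_nonneg_nonneg zero_le_power) simp_all
  finally show ?thesis by simp
qed

section \<open>Certificates as symmetric functions, and their inequalities in any order of the
  variables\<close>

definition h2 :: "real \<Rightarrow> real" where
  "h2 a = (if a < 2 then lo2 a else hi2 a)"

definition h3 :: "real \<Rightarrow> real \<Rightarrow> real" where
  "h3 a b = (if a + b < 3 then lo3 (max a b) (min a b) else hi3 (max a b) (min a b))"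

text \<open>Written through symmetric expressions so that invariance under swaps is immediate: with
  the maximum \<open>M\<close> split off, \<open>p\<close> and \<open>q\<close> are the sum and the
  product of the two smaller arguments.\<close>

definition h4 :: "real \<Rightarrow> real \<Rightarrow> real \<Rightarrow> real" where
  "h4 a b c =
     (let M = max a (max b c); p = a + b + c - M; q = a * b + a * c + b * c - M * p
      in if a + b + c < 4 then lo4 M p q else hi4 M p q)"

lemma h3_commute: "h3 a b = h3 b a"
  by (simp add: h3_def add.commute max.commute min.commute)

lemma h3_sorted: "b \<le> a \<Longrightarrow> h3 a b = (if a + b < 3 then lo3 a b else hi3 a b)"
  by (simp add: h3_def max_absorb1 min_absorb2)

lemma h4_swap: "h4 a b c = h4 b a c" "h4 a b c = h4 a c b"
  by (simp_all add: h4_def Let_def max.left_commute max.commute algebra_simps)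

lemma h4_sorted:
  "c \<le> b \<Longrightarrow> b \<le> a \<Longrightarrow>
     h4 a b c = (if a + b + c < 4 then lo4 a (b + c) (b * c) else hi4 a (b + c) (b * c))"
  by (simp add: h4_def Let_def max_absorb1 algebra_simps)

text \<open>Here \<open>A = 8\<close> and \<open>B = 18\<close>, so
  \<open>A / B = (2 / 3)^2\<close>; the bound -10 of the \<open>lt\<close> cases is
  \<open>A - B\<close>. By symmetry \<open>b \<le> a\<close> may be assumed.\<close>

lemma dual2:
  assumes "0 \<le> a" "a \<le> 3" "0 \<le> b" "b \<le> 3"
  shows "8 - 18 * of_bool (a + b < 3) \<le> (a - 1) * h2 b + (b - 1) * h2 a"
proof -
  have *: "8 - 18 * of_bool (a + b < 3) \<le> (a - 1) * h2 b + (b - 1) * h2 a"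
    if "0 \<le> b" "b \<le> a" "a \<le> 3" for a b
    using that dual2_lt_0 [of b a] dual2_lt_1 [of b a] dual2_ge_0 [of b a] dual2_ge_1 [of b a]
      dual2_ge_2 [of b a]
    by (simp add: h2_def split: if_splits)
  show ?thesis
    using * [of a b] * [of b a] assms by (cases "b \<le> a") (simp_all add: algebra_simps)
qed

lemma dual3_sorted:
  assumes "0 \<le> c" "c \<le> b" "b \<le> a" "a \<le> 4"
  shows "162 - 384 * of_bool (a + b + c < 4)
           \<le> (a - 1) * h3 b c + (b - 1) * h3 a c + (c - 1) * h3 a b"
proof (cases "a + b + c < 4")
  case True
  \<comment> \<open>There is no fourth case: \<open>3 \<le> b + c\<close> together with a total
    below 4 would force \<open>a < 1\<close> and hence \<open>b + c < 2\<close>.\<close>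
  then consider "a + b < 3" | "a + c < 3" "3 \<le> a + b" | "b + c < 3" "3 \<le> a + c"
    using assms by linarith
  then show ?thesis
    using assms True dual3_lt_0 [of b a c] dual3_lt_1 [of b a c] dual3_lt_2 [of b a c]
    by cases (auto simp: h3_sorted)
next
  case False
  then consider "a + b < 3" | "a + c < 3" "3 \<le> a + b" | "b + c < 3" "3 \<le> a + c" | "3 \<le> b + c"
    using assms by linarith
  then show ?thesis
    using assms False dual3_ge_0 [of b a c] dual3_ge_1 [of b a c] dual3_ge_2 [of b a c]
      dual3_ge_3 [of b a c]
    by cases (auto simp: h3_sorted)
qed

lemma dual4_sorted:
  assumes "0 \<le> d" "d \<le> c" "c \<le> b" "b \<le> a" "a \<le> 5"
  shows "3072 - 7500 * of_bool (a + b + c + d < 5)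
           \<le> (a - 1) * h4 b c d + (b - 1) * h4 a c d + (c - 1) * h4 a b d + (d - 1) * h4 a b c"
proof (cases "a + b + c + d < 5")
  case True
  \<comment> \<open>Likewise \<open>4 \<le> b + c + d\<close> would force \<open>a < 1\<close> and
    hence \<open>b + c + d < 3\<close>.\<close>
  then consider "a + b + c < 4" | "a + b + d < 4" "4 \<le> a + b + c"
    | "a + c + d < 4" "4 \<le> a + b + d" | "b + c + d < 4" "4 \<le> a + c + d"
    using assms by linarith
  then show ?thesis
    using assms True dual4_lt_0 [of b a c d] dual4_lt_1 [of b a c d] dual4_lt_2 [of b a c d]
      dual4_lt_3 [of b a c d]
    by cases (auto simp: h4_sorted)
next
  case False
  then consider "a + b + c < 4" | "a + b + d < 4" "4 \<le> a + b + c"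
    | "a + c + d < 4" "4 \<le> a + b + d" | "b + c + d < 4" "4 \<le> a + c + d" | "4 \<le> b + c + d"
    using assms by linarith
  then show ?thesis
    using assms False dual4_ge_0 [of b a c d] dual4_ge_1 [of b a c d] dual4_ge_2 [of b a c d]
      dual4_ge_3 [of b a c d] dual4_ge_4 [of b a c d]
    by cases (auto simp: h4_sorted)
qed

text \<open>Insertion sort by adjacent transpositions: order the last two arguments, then move the
  first into place. It reduces a symmetric inequality to sorted arguments.\<close>

lemma wlog_sorted3:
  fixes P :: "'a::linorder \<Rightarrow> 'a \<Rightarrow> 'a \<Rightarrow> bool"
  assumes swap12: "\<And>a b c. P b a c \<Longrightarrow> P a b c"
    and swap23: "\<And>a b c. P a c b \<Longrightarrow> P a b c"
    and sorted: "\<And>a b c. c \<le> b \<Longrightarrow> b \<le> a \<Longrightarrow> P a b c"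
  shows "P a b c"
proof -
  have *: "P a b c" if "c \<le> b" for a b c
  proof -
    consider "b \<le> a" | "a \<le> b" "c \<le> a" | "a \<le> c"
      using linear [of a b] linear [of a c] by blast
    then show ?thesis
    proof cases
      case 1
      show ?thesis by (rule sorted) fact+
    next
      case 2
      show ?thesis by (rule swap12, rule sorted) fact+
    next
      case 3
      show ?thesis by (rule swap12, rule swap23, rule sorted) fact+
    qed
  qed
  show ?thesis
    using * [of c b a] swap23 [OF * [of b c a]] linear [of b c] by blast
qed

text \<open>\<open>wlog_sorted3\<close> with the first argument fixed sorts the other three; the
  first is then inserted among them.\<close>

lemma wlog_sorted4:
  fixes P :: "'a::linorder \<Rightarrow> 'a \<Rightarrow> 'a \<Rightarrow> 'a \<Rightarrow> bool"
  assumes swap12: "\<And>a b c d. P b a c d \<Longrightarrow> P a b c d"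
    and swap23: "\<And>a b c d. P a c b d \<Longrightarrow> P a b c d"
    and swap34: "\<And>a b c d. P a b d c \<Longrightarrow> P a b c d"
    and sorted: "\<And>a b c d. d \<le> c \<Longrightarrow> c \<le> b \<Longrightarrow> b \<le> a \<Longrightarrow> P a b c d"
  shows "P a b c d"
proof (rule wlog_sorted3 [where P = "\<lambda>b c d. P a b c d"])
  fix b c d :: 'a assume "d \<le> c" "c \<le> b"
  then consider "b \<le> a" | "a \<le> b" "c \<le> a" | "a \<le> c" "d \<le> a" | "a \<le> d"
    using linear [of a b] linear [of a c] linear [of a d] by blast
  then show "P a b c d"
  proof cases
    case 1
    show ?thesis by (rule sorted) fact+
  next
    case 2
    show ?thesis by (rule swap12, rule sorted) fact+
  next
    case 3
    show ?thesis by (rule swap12, rule swap23, rule sorted) fact+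
  next
    case 4
    show ?thesis by (rule swap12, rule swap23, rule swap34, rule sorted) fact+
  qed
qed (erule swap23, erule swap34)

lemma dual3:
  assumes "0 \<le> a" "a \<le> 4" "0 \<le> b" "b \<le> 4" "0 \<le> c" "c \<le> 4"
  shows "162 - 384 * of_bool (a + b + c < 4)
           \<le> (a - 1) * h3 b c + (b - 1) * h3 a c + (c - 1) * h3 a b"
    (is "?Q a b c")
proof -
  let ?I = "{0..4::real}"
  have "a \<in> ?I \<longrightarrow> b \<in> ?I \<longrightarrow> c \<in> ?I \<longrightarrow> ?Q a b c"
  proof (rule wlog_sorted3 [where P = "\<lambda>a b c. a \<in> ?I \<longrightarrow> b \<in> ?I \<longrightarrow> c \<in> ?I \<longrightarrow> ?Q a b c"])
    fix a b c :: real assume "c \<le> b" "b \<le> a"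
    then show "a \<in> ?I \<longrightarrow> b \<in> ?I \<longrightarrow> c \<in> ?I \<longrightarrow> ?Q a b c"
      using dual3_sorted by simp
  qed (simp_all add: h3_commute add_ac)
  with assms show ?thesis by simp
qed

lemma dual4:
  assumes "0 \<le> a" "a \<le> 5" "0 \<le> b" "b \<le> 5" "0 \<le> c" "c \<le> 5" "0 \<le> d" "d \<le> 5"
  shows "3072 - 7500 * of_bool (a + b + c + d < 5)
           \<le> (a - 1) * h4 b c d + (b - 1) * h4 a c d + (c - 1) * h4 a b d + (d - 1) * h4 a b c"
    (is "?Q a b c d")
proof -
  let ?I = "{0..5::real}"
  let ?P = "\<lambda>a b c d. a \<in> ?I \<longrightarrow> b \<in> ?I \<longrightarrow> c \<in> ?I \<longrightarrow> d \<in> ?I \<longrightarrow> ?Q a b c d"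
  have "?P a b c d"
  proof (rule wlog_sorted4 [where P = ?P])
    fix a b c d :: real assume "d \<le> c" "c \<le> b" "b \<le> a"
    then show "?P a b c d"
      using dual4_sorted by simp
  qed (simp_all add: h4_swap add_ac)
  with assms show ?thesis by simp
qed

section \<open>The tail bound and counting subsets of large weight\<close>

text \<open>An expectation functional for a random variable with values in \<open>{0..t}\<close>,
  reduced to linearity, normalisation and monotonicity; nested applications model independent
  copies. The instances are the uniform mean over a finite set and the mixture of a given
  \<open>E\<close> with the point mass at \<open>t\<close>.\<close>

locale averaging =
  fixes E :: "(real \<Rightarrow> real) \<Rightarrow> real" and t :: real
  assumes add: "E (\<lambda>x. f x + g x) = E f + E g"
    and scale: "E (\<lambda>x. c * f x) = c * E f"
    and mono: "(\<And>x. 0 \<le> x \<Longrightarrow> x \<le> t \<Longrightarrow> f x \<le> g x) \<Longrightarrow> E f \<le> E g"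
    and one: "E (\<lambda>_. 1) = 1"
begin

lemma const: "E (\<lambda>_. c) = c"
  using scale [of c "\<lambda>_. 1"] one by simp

lemma diff: "E (\<lambda>x. f x - g x) = E f - E g"
  using add [of f "\<lambda>x. (- 1) * g x"] scale [of "- 1" g] by simp

lemma cong: "(\<And>x. 0 \<le> x \<Longrightarrow> x \<le> t \<Longrightarrow> f x = g x) \<Longrightarrow> E f = E g"
  by (intro antisym mono) simp_all

text \<open>Makes each certificate term vanish in expectation: \<open>c\<close> is the factor
  contributed by the other variables, constant while averaging over \<open>x\<close>.\<close>

lemma centred: "E (\<lambda>x. x) = 1 \<Longrightarrow> E (\<lambda>x. (x - 1) * c) = 0"
  using diff [of "\<lambda>x. c * x" "\<lambda>x. c"] scale [of c "\<lambda>x. x"] const [of c]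
  by (simp add: algebra_simps)

end

text \<open>\<open>below E t m s\<close> is the probability that \<open>s + X\<^sub>1 + \<dots> + X\<^sub>m < t\<close>, where the
  \<open>X\<^sub>i\<close> are independent copies of a random variable with expectation functional \<open>E\<close>.\<close>

primrec below :: "((real \<Rightarrow> real) \<Rightarrow> real) \<Rightarrow> real \<Rightarrow> nat \<Rightarrow> real \<Rightarrow> real" where
  "below E t 0 s = of_bool (s < t)"
| "below E t (Suc m) s = E (\<lambda>x. below E t m (s + x))"

context averaging
begin

lemma below_eq_0: "t \<le> s \<Longrightarrow> below E t m s = 0"
proof (induction m arbitrary: s)
  case (Suc m)
  have "E (\<lambda>x. below E t m (s + x)) = E (\<lambda>_. 0)"
    using Suc by (intro cong) simp
  then show ?case by (simp add: const)
qed simp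

text \<open>Average the certificate inequality over all variables. The certificate side vanishes
  term by term by \<open>centred\<close>, which leaves
  \<open>A - B * below E t m 0 \<le> 0\<close>.\<close>

lemma below_mean_one:
  assumes mean: "E (\<lambda>x. x) = 1" and m: "1 \<le> m" "m \<le> 4" and t: "t = real m + 1"
  shows "(real m / t) ^ m \<le> below E t m 0"
proof -
  note linear = add diff scale const centred [OF mean]
  consider "m = 1" | "m = 2" | "m = 3" | "m = 4" using m by linarith
  then show ?thesis
  proof cases
    case 1
    then have t: "t = 2" using t by simp
    \<comment> \<open>Markov's inequality, which is the certificate with constant
      \<open>h = 1\<close>.\<close>
    have "E (\<lambda>a. 2 - a) \<le> E (\<lambda>a. 2 * of_bool (a < 2))"
      by (rule mono) (auto simp: t)
    with 1 show ?thesis by (simp add: t linear mean)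
  next
    case 2
    then have t: "t = 3" using t by simp
    have "E (\<lambda>a. E (\<lambda>b. 8 - 18 * of_bool (a + b < 3)))
       \<le> E (\<lambda>a. E (\<lambda>b. (a - 1) * h2 b + (b - 1) * h2 a))"
      by (intro mono dual2) (simp_all add: t)
    with 2 show ?thesis by (simp add: t linear power2_eq_square numeral_2_eq_2)
  next
    case 3
    then have t: "t = 4" using t by simp
    have "E (\<lambda>a. E (\<lambda>b. E (\<lambda>c. 162 - 384 * of_bool (a + b + c < 4))))
       \<le> E (\<lambda>a. E (\<lambda>b. E (\<lambda>c. (a - 1) * h3 b c + (b - 1) * h3 a c + (c - 1) * h3 a b)))"
      by (intro mono dual3) (simp_all add: t)
    with 3 show ?thesis by (simp add: t linear power3_eq_cube numeral_3_eq_3)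
  next
    case 4
    then have t: "t = 5" using t by simp
    have "E (\<lambda>a. E (\<lambda>b. E (\<lambda>c. E (\<lambda>d. 3072 - 7500 * of_bool (a + b + c + d < 5)))))
       \<le> E (\<lambda>a. E (\<lambda>b. E (\<lambda>c. E (\<lambda>d. (a - 1) * h4 b c d + (b - 1) * h4 a c d
           + (c - 1) * h4 a b d + (d - 1) * h4 a b c))))"
      by (intro mono dual4) (simp_all add: t)
    then have "3072 - 7500 * E (\<lambda>a. E (\<lambda>b. E (\<lambda>c. E (\<lambda>d. of_bool (a + b + c + d < 5))))) \<le> 0"
      by (simp add: linear)
    with 4 show ?thesis by (simp add: t eval_nat_numeral)
  qed
qed

text \<open>A mean below one is raised to one by mixing in the value \<open>t\<close>; an outcome containing this
  value is never below \<open>t\<close>, so the probability only scales.\<close>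

lemma below_ge:
  assumes mean: "E (\<lambda>x. x) = \<mu>" "\<mu> \<le> 1" and m: "1 \<le> m" "m \<le> 4" and t: "t = real m + 1"
  shows "(1 - \<mu> / t) ^ m \<le> below E t m 0"
proof -
  \<comment> \<open>The solution of \<open>q * t + (1 - q) * \<mu> = 1\<close>, so that the mixture
    \<open>F\<close> has mean one.\<close>
  define q where "q = (1 - \<mu>) / (t - \<mu>)"
  have nonzero: "t - \<mu> > 0" "t \<noteq> 0" "real m \<noteq> 0" using assms by simp_all
  then have q: "0 \<le> q" "q < 1" "1 - q = real m / (t - \<mu>)"
    using mean m t by (simp_all add: q_def field_simps)
  define F where "F g = q * g t + (1 - q) * E g" for g
  interpret F: averaging F t
  proof
    show "F f \<le> F g" if "\<And>x. 0 \<le> x \<Longrightarrow> x \<le> t \<Longrightarrow> f x \<le> g x" for f g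
      unfolding F_def using q that t by (intro add_mono mult_left_mono mono) simp_all
  qed (simp_all add: F_def add scale one algebra_simps)
  have "F (\<lambda>x. x) = \<mu> + q * (t - \<mu>)"
    by (simp add: F_def mean algebra_simps)
  also have "\<dots> = 1"
    using nonzero by (simp add: q_def)
  finally have "(real m / t) ^ m \<le> below F t m 0"
    using m t by (rule F.below_mean_one)
  \<comment> \<open>From a start \<open>s \<ge> 0\<close>, drawing the value \<open>t\<close>
    contributes nothing, so each of the \<open>j\<close> draws only costs a factor
    \<open>1 - q\<close>.\<close>
  also have "below F t j s = (1 - q) ^ j * below E t j s" if "0 \<le> s" for j s
    using that
  proof (induction j arbitrary: s)
    case (Suc j)
    have "below F t (Suc j) s = (1 - q) * E (\<lambda>x. below F t j (s + x))"
      using F.below_eq_0 [of "s + t" j] Suc.prems by (simp add: F_def [of "\<lambda>x. below F t j (s + x)"])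
    also have "E (\<lambda>x. below F t j (s + x)) = E (\<lambda>x. (1 - q) ^ j * below E t j (s + x))"
      using Suc by (intro cong) simp
    finally show ?case by (simp add: scale)
  qed simp
  finally have "(real m / t) ^ m \<le> (1 - q) ^ m * below E t m 0" by simp
  then have "(real m / t) ^ m / (1 - q) ^ m \<le> below E t m 0"
    using q(2) by (simp add: pos_divide_le_eq mult.commute)
  then have "(real m / t / (1 - q)) ^ m \<le> below E t m 0"
    by (simp only: power_divide)
  also have "real m / t / (1 - q) = 1 - \<mu> / t"
    unfolding q(3) using nonzero by (simp add: diff_divide_distrib)
  finally show ?thesis .
qed

end

section \<open>Counting subsets through independent sampling\<close>

lemma averaging_mean:
  assumes "finite V" "V \<noteq> {}" "\<And>v. v \<in> V \<Longrightarrow> 0 \<le> y v \<and> y v \<le> t"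
  shows "averaging (\<lambda>g. (\<Sum>v\<in>V. g (y v)) / card V) t"
proof
  show "(\<Sum>v\<in>V. f (y v)) / card V \<le> (\<Sum>v\<in>V. g (y v)) / card V"
    if "\<And>x. 0 \<le> x \<Longrightarrow> x \<le> t \<Longrightarrow> f x \<le> g x" for f g
    using assms that by (intro divide_right_mono sum_mono) auto
qed (use assms in \<open>simp_all add: sum.distrib add_divide_distrib sum_distrib_left [symmetric]\<close>)

text \<open>The left side counts \<open>m\<close>-tuples without repetition whose weights lift
  \<open>s\<close> to at least \<open>t\<close>. Independent uniform draws also produce tuples with
  repetitions, hence the inequality.\<close>

lemma card_subsets_ge_le:
  fixes V :: "'v set" and y :: "'v \<Rightarrow> real"
  assumes V: "finite V" "V \<noteq> {}"
  defines "E \<equiv> \<lambda>g. (\<Sum>v\<in>V. g (y v)) / card V"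
  shows "fact m * real (card {T. T \<subseteq> V \<and> card T = m \<and> t \<le> s + sum y T})
           \<le> real (card V) ^ m * (1 - below E t m s)"
proof (induction m arbitrary: s)
  case 0
  have "{T. T \<subseteq> V \<and> card T = 0 \<and> t \<le> s + sum y T} = (if t \<le> s then {{}} else {})"
    using V by (auto dest: finite_subset)
  then show ?case by auto
next
  case (Suc m)
  define N where "N m s = {T. T \<subseteq> V \<and> card T = m \<and> t \<le> s + sum y T}" for m s
  have fin: "finite (N m s)" for m s
    using V by (auto simp: N_def)
  \<comment> \<open>Double counting of pairs of a set and one of its elements \<open>v\<close>;
    deleting \<open>v\<close> moves \<open>y v\<close> into the start value.\<close>
  have "Suc m * card (N (Suc m) s) = (\<Sum>T\<in>N (Suc m) s. card T)"
    by (simp add: N_def)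
  also have "\<dots> = (\<Sum>T\<in>N (Suc m) s. \<Sum>v\<in>V. of_bool (v \<in> T))"
  proof (intro sum.cong refl)
    fix T assume "T \<in> N (Suc m) s"
    then have "V \<inter> T = T" by (auto simp: N_def)
    then show "card T = (\<Sum>v\<in>V. of_bool (v \<in> T))"
      using V by (simp add: of_bool_def sum.If_cases Int_def [symmetric] Collect_mem_eq)
  qed
  also have "\<dots> = (\<Sum>v\<in>V. \<Sum>T\<in>N (Suc m) s. of_bool (v \<in> T))"
    by (rule sum.swap)
  also have "\<dots> = (\<Sum>v\<in>V. card {T \<in> N (Suc m) s. v \<in> T})"
    using fin by (simp add: of_bool_def sum.If_cases Int_def)
  also have "\<dots> \<le> (\<Sum>v\<in>V. card (N m (s + y v)))"
  proof (intro sum_mono card_inj_on_le [OF _ _ fin])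
    fix v assume "v \<in> V"
    show "inj_on (\<lambda>T. T - {v}) {T \<in> N (Suc m) s. v \<in> T}"
      by (rule inj_onI) blast
    show "(\<lambda>T. T - {v}) ` {T \<in> N (Suc m) s. v \<in> T} \<subseteq> N m (s + y v)"
      using V by (auto simp: N_def sum_diff1 card_Diff_singleton dest: finite_subset)
  qed
  finally have "fact (Suc m) * real (card (N (Suc m) s)) \<le> (\<Sum>v\<in>V. fact m * real (card (N m (s + y v))))"
    by (simp add: sum_distrib_left [symmetric] mult_ac flip: of_nat_sum of_nat_mult of_nat_Suc)
  also have "\<dots> \<le> (\<Sum>v\<in>V. real (card V) ^ m * (1 - below E t m (s + y v)))"
    unfolding N_def by (intro sum_mono Suc.IH)
  also have "\<dots> = real (card V) ^ Suc m * (1 - below E t (Suc m) s)"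
    using V by (simp add: E_def sum_distrib_left [symmetric] sum_subtractf field_simps)
  finally show ?case by (simp add: N_def)
qed

text \<open>Rescaling \<open>k\<close> times the mean of \<open>f\<close> to
  \<open>t = m + 1\<close> and truncating at \<open>t\<close> gives values in \<open>{0..t}\<close>
  of mean \<open>\<mu> \<le> t / k \<le> 1\<close>. Then \<open>below_ge\<close> applies, and
  \<open>1 - \<mu> / t \<ge> (k - 1) / k\<close>.\<close>

lemma card_subsets_above_mean:
  fixes V :: "'v set" and f :: "'v \<Rightarrow> real"
  assumes V: "finite V" "V \<noteq> {}" and f: "\<And>v. v \<in> V \<Longrightarrow> 0 \<le> f v"
    and m: "1 \<le> m" "m \<le> 4" "m < k"
  shows "fact m * real (card {T. T \<subseteq> V \<and> card T = m \<and> real k * (sum f V / card V) < sum f T})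
           \<le> real (card V) ^ m * (1 - ((real k - 1) / real k) ^ m)"
    (is "fact m * real (card ?A) \<le> _")
proof (cases "sum f V = 0")
  case True
  then have "f v = 0" if "v \<in> V" for v
    using sum_nonneg_eq_0_iff [of V f] V f that by simp
  then have "sum f T = 0" if "T \<subseteq> V" for T
    using that by (auto intro!: sum.neutral)
  \<comment> \<open>Rescaling would divide by zero here, but the strict inequality reads
    \<open>0 < 0\<close> and leaves no set.\<close>
  with True have A: "?A = {}" by auto
  have "((real k - 1) / real k) ^ m \<le> 1"
    using m by (intro power_le_one) simp_all
  then show ?thesis unfolding A by simp
next
  case False
  then have pos: "0 < sum f V"
    using sum_nonneg [of V f] f by fastforce
  define t where "t = real m + 1"
  define \<theta> where "\<theta> = real k * (sum f V / card V)"
  have n: "0 < real (card V)" using V by (simp add: card_gt_0_iff)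
  have \<theta>: "0 < \<theta>" using pos m n by (simp add: \<theta>_def)
  define y where "y v = min t (t * f v / \<theta>)" for v
  define E where "E g = (\<Sum>v\<in>V. g (y v)) / card V" for g :: "real \<Rightarrow> real"
  have t: "0 < t" by (simp add: t_def)
  have y: "0 \<le> y v" "y v \<le> t" if "v \<in> V" for v
    using that f \<theta> t by (simp_all add: y_def)
  interpret averaging E t
    unfolding E_def using V y by (intro averaging_mean) simp_all
  have "E (\<lambda>x. x) \<le> (\<Sum>v\<in>V. t * f v / \<theta>) / card V"
    unfolding E_def y_def by (intro divide_right_mono sum_mono) simp_all
  also have "\<dots> = t * sum f V / \<theta> / card V"
    by (simp add: sum_divide_distrib sum_distrib_left)
  also have "\<dots> = t / real k"
    using pos n m by (simp add: \<theta>_def)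
  finally have mean: "E (\<lambda>x. x) \<le> t / real k" .
  also have "\<dots> \<le> 1" using m by (simp add: t_def)
  finally have "(1 - E (\<lambda>x. x) / t) ^ m \<le> below E t m 0"
    using m by (intro below_ge) (simp_all add: t_def)
  moreover have "((real k - 1) / real k) ^ m \<le> (1 - E (\<lambda>x. x) / t) ^ m"
    using mean m t by (intro power_mono) (simp_all add: field_simps)
  ultimately have below: "((real k - 1) / real k) ^ m \<le> below E t m 0" by linarith
  have "?A \<subseteq> {T. T \<subseteq> V \<and> card T = m \<and> t \<le> 0 + sum y T}"
  proof (rule subsetI)
    fix T assume A: "T \<in> ?A"
    then have T: "T \<subseteq> V" and gt: "real k * (sum f V / card V) < sum f T" by simp_all
    have fin: "finite T" using T V by (auto dest: finite_subset)
    \<comment> \<open>Truncation loses no set: one truncated element already reaches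
      \<open>t\<close>, and without any, \<open>y\<close> is the plain rescaling of \<open>f\<close>
      on \<open>T\<close>.\<close>
    have "t \<le> sum y T"
    proof (cases "\<exists>v\<in>T. y v = t")
      case True
      then obtain v where "v \<in> T" "y v = t" by blast
      then show ?thesis
        using member_le_sum [of v T y] fin T y by auto
    next
      case False
      then have "y v = t * f v / \<theta>" if "v \<in> T" for v
        using that by (force simp: y_def)
      then have "sum y T = t * (sum f T / \<theta>)"
        by (simp add: sum_divide_distrib [symmetric] sum_distrib_left [symmetric])
      moreover have "1 \<le> sum f T / \<theta>"
        using gt \<theta> unfolding \<theta>_def [symmetric] by simp
      ultimately show ?thesis
        using mult_left_mono [of 1 "sum f T / \<theta>" t] t by simp
    qed
    with A show "T \<in> {T. T \<subseteq> V \<and> card T = m \<and> t \<le> 0 + sum y T}" by simp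
  qed
  then have "card ?A \<le> card {T. T \<subseteq> V \<and> card T = m \<and> t \<le> 0 + sum y T}"
    using V by (intro card_mono) auto
  then have "fact m * real (card ?A) \<le> fact m * real (card {T. T \<subseteq> V \<and> card T = m \<and> t \<le> 0 + sum y T})"
    by simp
  also have "\<dots> \<le> real (card V) ^ m * (1 - below E t m 0)"
    unfolding E_def by (rule card_subsets_ge_le [OF V])
  also have "\<dots> \<le> real (card V) ^ m * (1 - ((real k - 1) / real k) ^ m)"
    using below by (intro mult_left_mono) simp_all
  finally show ?thesis .
qed

section \<open>The degree threshold\<close>

lemma exists_smallest_subset:
  fixes u :: "'v \<Rightarrow> 'a::linorder"
  assumes "finite V" "d \<le> card V"
  shows "\<exists>S\<subseteq>V. card S = d \<and> (\<forall>s\<in>S. \<forall>v\<in>V - S. u s \<le> u v)"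
  using assms(2)
proof (induction d)
  case 0
  then show ?case by (intro exI [of _ "{}"]) simp
next
  case (Suc d)
  then obtain S where S: "S \<subseteq> V" "card S = d" "\<forall>s\<in>S. \<forall>v\<in>V - S. u s \<le> u v" by auto
  have "finite (V - S)" "V - S \<noteq> {}"
    using assms(1) S Suc.prems card_mono [of S V] finite_subset [of S V] by auto
  then have "Min (u ` (V - S)) \<in> u ` (V - S)" by (intro Min_in) auto
  then obtain x where x: "x \<in> V - S" "u x = Min (u ` (V - S))" by auto
  then have "u x \<le> u v" if "v \<in> V - S" for v
    using \<open>finite (V - S)\<close> that by simp
  moreover have "card (insert x S) = Suc d"
    using x S assms(1) finite_subset [of S V] by simp
  ultimately show ?case
    using x S by (intro exI [of _ "insert x S"]) auto
qed

text \<open>For an edge \<open>e\<close> containing \<open>S\<close>,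
  \<open>sum f (e - S) = sum u e + \<sigma> - k * \<tau>\<close>, while \<open>k\<close> times the
  mean of \<open>f\<close> is \<open>k * sum u V / n + (k / n) * \<sigma> - k * \<tau>\<close>. The
  latter is smaller because \<open>sum u V < 0 \<le> sum u e\<close>, \<open>k \<le> n\<close> and
  \<open>0 \<le> \<sigma>\<close>. So the sets \<open>e - S\<close> are among those counted by
  \<open>card_subsets_above_mean\<close>.\<close>

lemma min_degree_bound:
  fixes V :: "'v set"
  assumes H: "k_graph k V E" and d: "1 \<le> d" "d < k" "k - d \<le> 4" and n: "k \<le> card V"
    and less: "fractional_matching_number V E < real (card V) / real k"
  shows "fact (k - d) * real (min_degree d V E)
           \<le> real (card V) ^ (k - d) * (1 - ((real k - 1) / real k) ^ (k - d))"
proof -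
  define n where "n = card V"
  have fin: "finite V" and E: "\<And>e. e \<in> E \<Longrightarrow> e \<subseteq> V \<and> card e = k"
    using H by (auto simp: k_graph_def)
  have "V \<noteq> {}" using assms by auto
  have npos: "0 < real n" "real k \<le> real n" using assms by (simp_all add: n_def)
  obtain u :: "'v \<Rightarrow> real" where u: "\<And>e. e \<in> E \<Longrightarrow> 0 \<le> sum u e" "sum u V < 0"
    using no_perfect_fractional_matching [OF H _ less] d by auto
  obtain S where S: "S \<subseteq> V" "card S = d" and smallest: "\<forall>s\<in>S. \<forall>v\<in>V - S. u s \<le> u v"
    using exists_smallest_subset [OF fin, of d u] assms by auto
  have finS: "finite S" "S \<noteq> {}" using S d fin finite_subset [of S V] by auto
  define \<tau> where "\<tau> = Max (u ` S)"
  have le_\<tau>: "u s \<le> \<tau>" if "s \<in> S" for s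
    using that finS by (simp add: \<tau>_def)
  have ge_\<tau>: "\<tau> \<le> u v" if "v \<in> V - S" for v
    using that finS smallest by (simp add: \<tau>_def)
  define f where "f v = max 0 (u v - \<tau>)" for v
  \<comment> \<open>The amount by which the weight of \<open>S\<close> falls short of constant
    weight \<open>\<tau>\<close>.\<close>
  define \<sigma> where "\<sigma> = real d * \<tau> - sum u S"
  have \<sigma>: "0 \<le> \<sigma>"
    using sum_bounded_above [of S u \<tau>] le_\<tau> S by (simp add: \<sigma>_def)
  have f_sum: "sum f T = sum u T - real (card T) * \<tau>" if "T \<subseteq> V - S" for T
  proof -
    have "sum f T = (\<Sum>v\<in>T. u v - \<tau>)"
      using that ge_\<tau> by (intro sum.cong refl) (auto simp: f_def max_def)
    then show ?thesis by (simp add: sum_subtractf)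
  qed
  have f_total: "sum f V = sum u V + \<sigma> - real n * \<tau>"
  proof -
    have "sum f V = sum f (V - S)"
      using fin le_\<tau> by (intro sum.mono_neutral_right) (auto simp: f_def max_def intro: antisym)
    also have "\<dots> = sum u (V - S) - real (card (V - S)) * \<tau>"
      by (rule f_sum) simp
    also have "\<dots> = sum u V - sum u S - (real n - real d) * \<tau>"
      using S finS fin assms by (simp add: sum_diff card_Diff_subset n_def of_nat_diff)
    finally show ?thesis by (simp add: \<sigma>_def algebra_simps)
  qed
  let ?A = "{T. T \<subseteq> V \<and> card T = k - d \<and> real k * (sum f V / card V) < sum f T}"
  have "card {e \<in> E. S \<subseteq> e} \<le> card ?A"
  proof (rule card_inj_on_le)
    show "inj_on (\<lambda>e. e - S) {e \<in> E. S \<subseteq> e}" by (rule inj_onI) blast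
    show "finite ?A" using fin by simp
    show "(\<lambda>e. e - S) ` {e \<in> E. S \<subseteq> e} \<subseteq> ?A"
    proof safe
      fix e assume e: "e \<in> E" "S \<subseteq> e"
      have "finite e" using E [OF e(1)] fin finite_subset by blast
      show "card (e - S) = k - d"
        using e E finS S by (simp add: card_Diff_subset)
      have "e - S \<subseteq> V - S" using E [OF e(1)] by blast
      then have "sum f (e - S) = sum u (e - S) - real (card (e - S)) * \<tau>"
        by (rule f_sum)
      then have "sum f (e - S) = sum u e + \<sigma> - real k * \<tau>"
        using sum_diff [OF \<open>finite e\<close> e(2), of u] d
        by (simp add: \<open>card (e - S) = k - d\<close> \<sigma>_def of_nat_diff algebra_simps)
      moreover have "real k * (sum f V / card V)
          = real k * (sum u V / n) + real k / n * \<sigma> - real k * \<tau>"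
        using npos by (simp add: f_total n_def [symmetric] field_simps)
      moreover have "real k / n * \<sigma> \<le> 1 * \<sigma>"
        using npos \<sigma> by (intro mult_right_mono) simp_all
      moreover have "real k * (sum u V / n) < 0"
        using u(2) npos d by (simp add: mult_pos_neg divide_neg_pos)
      moreover have "0 \<le> sum u e" using e by (intro u)
      ultimately show "real k * (sum f V / card V) < sum f (e - S)" by linarith
    qed (use E in blast)
  qed
  moreover have "min_degree d V E \<le> card {e \<in> E. S \<subseteq> e}"
    unfolding min_degree_def hdegree_def [symmetric]
    using fin S by (intro Min_le) auto
  ultimately have "fact (k - d) * real (min_degree d V E) \<le> fact (k - d) * real (card ?A)"
    by simp
  also have "\<dots> \<le> real (card V) ^ (k - d) * (1 - ((real k - 1) / real k) ^ (k - d))"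
    using fin \<open>V \<noteq> {}\<close> d by (intro card_subsets_above_mean) (auto simp: f_def)
  finally show ?thesis .
qed

section \<open>Lower bound: the \<open>k\<close>-sets that meet a fixed vertex set\<close>

lemma le_min_degree:
  assumes "finite V" "d \<le> card V"
    and "\<And>S. S \<subseteq> V \<Longrightarrow> card S = d \<Longrightarrow> x \<le> hdegree E S"
  shows "x \<le> min_degree d V E"
proof -
  obtain S where "S \<subseteq> V" "card S = d"
    using obtain_subset_with_card_n [OF assms(2)] by blast
  then show ?thesis
    unfolding min_degree_def using assms by (intro Min.boundedI) auto
qed

text \<open>Weak linear programming duality: the weight of each edge is charged to a cover vertex in
  it, and a vertex receives at most 1.\<close>

lemma fractional_matching_number_cover:
  assumes "finite E" "finite A" "A \<subseteq> V" and cover: "\<And>e. e \<in> E \<Longrightarrow> e \<inter> A \<noteq> {}"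
  shows "fractional_matching_number V E \<le> card A"
proof (rule fractional_matching_number_least)
  fix w assume w: "fractional_matching V E w"
  have "sum w E \<le> (\<Sum>e\<in>E. \<Sum>v\<in>A. of_bool (v \<in> e) * w e)"
  proof (rule sum_mono)
    fix e assume "e \<in> E"
    then obtain v where "v \<in> e" "v \<in> A" using cover by blast
    moreover have "0 \<le> w e" using w \<open>e \<in> E\<close> by (simp add: fractional_matching_def)
    ultimately show "w e \<le> (\<Sum>v\<in>A. of_bool (v \<in> e) * w e)"
      using member_le_sum [of v A "\<lambda>v. of_bool (v \<in> e) * w e"] assms by simp
  qed
  also have "\<dots> = (\<Sum>v\<in>A. \<Sum>e\<in>{e \<in> E. v \<in> e}. w e)"
    using assms(1) by (subst sum.swap, intro sum.cong refl sum.mono_neutral_cong_right) auto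
  also have "\<dots> \<le> (\<Sum>v\<in>A. 1)"
    using w assms(3) by (intro sum_mono) (auto simp: fractional_matching_def)
  finally show "sum w E \<le> card A" by simp
qed

text \<open>Adding \<open>S\<close> to an \<open>m\<close>-set outside \<open>S\<close> gives an
  edge unless the union misses \<open>A\<close>. The failures are \<open>m\<close>-sets avoiding
  both \<open>S\<close> and \<open>A\<close>, and there are none if \<open>S\<close> meets
  \<open>A\<close>.\<close>

lemma hdegree_meeting:
  fixes V A S :: "'v set"
  assumes V: "finite V" "A \<subseteq> V" "S \<subseteq> V" and k: "card S \<le> k"
  defines "m \<equiv> k - card S"
  shows "(card V - card S choose m) - (card V - card S - card A choose m)
           \<le> hdegree {e. e \<subseteq> V \<and> card e = k \<and> e \<inter> A \<noteq> {}} S"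
proof -
  let ?E = "{e. e \<subseteq> V \<and> card e = k \<and> e \<inter> A \<noteq> {}}"
  have fin: "finite A" "finite S" using V finite_subset by blast+
  define B where "B = {T. T \<subseteq> V - S \<and> card T = m}"
  define C where "C = {T \<in> B. (T \<union> S) \<inter> A = {}}"
  have "finite B" using V by (simp add: B_def)
  have card_B: "card B = (card V - card S choose m)"
    using V fin n_subsets [of "V - S" m] by (simp add: B_def card_Diff_subset)
  have card_C: "card C \<le> (card V - card S - card A choose m)"
  proof (cases "S \<inter> A = {}")
    case True
    have "C \<subseteq> {T. T \<subseteq> V - S - A \<and> card T = m}"
      by (auto simp: B_def C_def)
    then have "card C \<le> card {T. T \<subseteq> V - S - A \<and> card T = m}"
      using V by (intro card_mono) auto
    also have "\<dots> = (card (V - S - A) choose m)"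
      using V by (intro n_subsets) simp
    also have "card (V - S - A) = card V - card S - card A"
      using V fin True by (subst card_Diff_subset) (auto simp: card_Diff_subset)
    finally show ?thesis .
  next
    case False
    then have "C = {}" by (auto simp: C_def)
    then show ?thesis by simp
  qed
  have "card (B - C) \<le> card {e \<in> ?E. S \<subseteq> e}"
  proof (rule card_inj_on_le)
    show "inj_on (\<lambda>T. T \<union> S) (B - C)"
      by (rule inj_onI) (auto simp: B_def)
    show "finite {e \<in> ?E. S \<subseteq> e}" using V by simp
    show "(\<lambda>T. T \<union> S) ` (B - C) \<subseteq> {e \<in> ?E. S \<subseteq> e}"
    proof (rule image_subsetI)
      fix T assume T: "T \<in> B - C"
      then have "finite T" "T \<inter> S = {}"
        using V finite_subset [of T V] by (auto simp: B_def)
      then have "card (T \<union> S) = k"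
        using T k fin by (simp add: B_def m_def card_Un_disjoint)
      then show "T \<union> S \<in> {e \<in> ?E. S \<subseteq> e}"
        using T V by (auto simp: B_def C_def)
    qed
  qed
  moreover have "card (B - C) = card B - card C"
    using \<open>finite B\<close> by (intro card_Diff_subset) (auto simp: C_def finite_subset)
  ultimately show ?thesis
    using card_B card_C by (simp add: hdegree_def)
qed

text \<open>Upper bound: by \<open>min_degree_bound\<close>, every integer above the real bound is
  admissible. Lower bound: the \<open>k\<close>-sets meeting \<open>a\<close> fixed vertices are
  covered by these vertices, and \<open>a\<close> is the largest integer with
  \<open>a * k < n\<close>.\<close>

lemma pfm_threshold_bounds:
  fixes k d n :: nat
  assumes d: "1 \<le> d" "d < k" "k - d \<le> 4" and n: "k \<le> n"
  defines "m \<equiv> k - d" and "a \<equiv> (n - 1) div k"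
  shows "real (n - d choose m) - real (n - d - a choose m) \<le> real (pfm_threshold d k n)" (is ?lower)
    and "real (pfm_threshold d k n) \<le> real n ^ m * (1 - ((real k - 1) / real k) ^ m) / fact m + 1"
      (is ?upper)
proof -
  define P where "P j \<longleftrightarrow> (\<forall>(V :: nat set) E.
      k_graph k V E \<and> card V = n \<and> min_degree d V E \<ge> j \<longrightarrow>
        fractional_matching_number V E \<ge> real n / real k)" for j
  have threshold: "pfm_threshold d k n = (LEAST j. P j)"
    by (simp add: pfm_threshold_def P_def)
  define x where "x = real n ^ m * (1 - ((real k - 1) / real k) ^ m) / fact m"
  have "((real k - 1) / real k) ^ m \<le> 1" using d by (intro power_le_one) simp_all
  then have "0 \<le> x" by (simp add: x_def)
  \<comment> \<open>The least integer above \<open>x\<close>. That \<open>P\<close> holds somewhere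
    also gives \<open>LEAST\<close> its meaning.\<close>
  have P: "P (nat \<lfloor>x\<rfloor> + 1)"
    unfolding P_def
  proof (intro allI impI, rule ccontr)
    fix V :: "nat set" and E
    assume H: "k_graph k V E \<and> card V = n \<and> nat \<lfloor>x\<rfloor> + 1 \<le> min_degree d V E"
      and "\<not> real n / real k \<le> fractional_matching_number V E"
    then have "fact m * real (min_degree d V E) \<le> fact m * x"
      using min_degree_bound [of k V E d] d n by (simp add: x_def m_def)
    then have "real (min_degree d V E) \<le> x" by simp
    moreover have "x < real (nat \<lfloor>x\<rfloor> + 1)" using \<open>0 \<le> x\<close> by linarith
    ultimately show False using H by linarith
  qed
  have "pfm_threshold d k n \<le> nat \<lfloor>x\<rfloor> + 1"
    unfolding threshold by (rule Least_le [of P, OF P])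
  moreover have "real (nat \<lfloor>x\<rfloor> + 1) \<le> x + 1" using \<open>0 \<le> x\<close> by linarith
  ultimately have "real (pfm_threshold d k n) \<le> x + 1" by linarith
  then show ?upper by (simp add: x_def)

  define V where "V = {..<n}"
  define A where "A = {..<a}"
  define E where "E = {e. e \<subseteq> V \<and> card e = k \<and> e \<inter> A \<noteq> {}}"
  have ak: "a * k < n"
    using d n div_times_less_eq_dividend [of "n - 1" k] unfolding a_def by linarith
  have "a \<le> n - 1" by (simp add: a_def)
  then have "A \<subseteq> V" by (auto simp: A_def V_def)
  have fin: "finite V" "card V = n" "card A = a" "finite A" by (simp_all add: V_def A_def)
  have "finite E" using fin by (simp add: E_def)
  have H: "k_graph k V E" using fin by (auto simp: k_graph_def E_def)
  have "fractional_matching_number V E \<le> real (card A)"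
    using \<open>finite E\<close> fin \<open>A \<subseteq> V\<close> by (intro fractional_matching_number_cover) (auto simp: E_def)
  also have "\<dots> < real n / real k"
    using ak d fin by (simp add: pos_less_divide_eq flip: of_nat_mult)
  finally have "\<not> real n / real k \<le> fractional_matching_number V E" by simp
  moreover have "P (pfm_threshold d k n)"
    unfolding threshold using P by (rule LeastI)
  note this [unfolded P_def, rule_format, of V E]
  \<comment> \<open>The graph violates the conclusion of \<open>P\<close>, so it must violate the
    degree condition.\<close>
  ultimately have "\<not> pfm_threshold d k n \<le> min_degree d V E"
    using H fin by auto
  moreover have "(n - d choose m) - (n - d - a choose m) \<le> min_degree d V E"
  proof (rule le_min_degree)
    fix S assume "S \<subseteq> V" "card S = d"
    then show "(n - d choose m) - (n - d - a choose m) \<le> hdegree E S"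
      using hdegree_meeting [of V A S k] fin \<open>A \<subseteq> V\<close> d by (simp add: E_def m_def)
  qed (use fin d n in simp_all)
  ultimately show ?lower by linarith
qed

section \<open>Asymptotics of the two bounds\<close>

lemma binomial_ratio_tendsto:
  fixes N :: "nat \<Rightarrow> nat"
  assumes "(\<lambda>n. real (N n) / real n) \<longlonglongrightarrow> c"
  shows "(\<lambda>n. fact m * real (N n choose m) / real n ^ m) \<longlonglongrightarrow> c ^ m"
proof -
  have "(\<lambda>n. \<Prod>i<m. (real (N n) / real n - real i / real n)) \<longlonglongrightarrow> (\<Prod>i<m. c - 0)"
    by (intro tendsto_prod tendsto_diff assms lim_const_over_n)
  \<comment> \<open>\<open>fact m * (N n choose m)\<close> is a falling factorial, and each of its
    \<open>m\<close> factors is divided by \<open>n\<close>.\<close>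
  moreover have "(\<Prod>i<m. (real (N n) / real n - real i / real n))
      = fact m * real (N n choose m) / real n ^ m" for n
    by (simp add: binomial_gbinomial gbinomial_prod_rev prod_dividef atLeast0LessThan
        flip: diff_divide_distrib)
  ultimately show ?thesis by simp
qed

theorem theorem1p2:
  fixes k d :: nat
  assumes "k \<ge> 3" and "d \<ge> 1" and "int k - 4 \<le> int d" and "int d \<le> int k - 1"
  shows "(\<lambda>n. real (pfm_threshold d k n)) \<sim>[at_top]
           (\<lambda>n. (1 - ((real k - 1) / real k) ^ (k - d)) * real ((n - d) choose (k - d)))"
proof -
  define m where "m = k - d"
  define C where "C = 1 - ((real k - 1) / real k) ^ m"
  define a where "a n = (n - 1) div k" for n
  \<comment> \<open>Everything is measured against \<open>n ^ m / fact m\<close>, where finite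
    limits exist.\<close>
  define scaled where "scaled x n = fact m * x / real n ^ m" for x :: real and n
  have d: "1 \<le> d" "d < k" "k - d \<le> 4" and m: "0 < m" using assms by (auto simp: m_def)
  have "((real k - 1) / real k) ^ m < 1" using assms m by (intro power_less_one_iff [THEN iffD2]) simp_all
  then have "C \<noteq> 0" by (simp add: C_def)

  have lim_d: "(\<lambda>n. real (n - d) / real n) \<longlonglongrightarrow> 1"
  proof (rule Lim_transform_eventually)
    show "(\<lambda>n. 1 - real d / real n) \<longlonglongrightarrow> 1"
      using tendsto_diff [OF tendsto_const [of 1] lim_const_over_n [of "real d"]] by simp
    show "\<forall>\<^sub>F n in sequentially. 1 - real d / real n = real (n - d) / real n"
      using eventually_ge_at_top [of "Suc d"] by eventually_elim (simp add: of_nat_diff field_simps)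
  qed
  \<comment> \<open>\<open>a n\<close> differs from \<open>n / k\<close> by at most one.\<close>
  have lim_a: "(\<lambda>n. real (a n) / real n) \<longlonglongrightarrow> 1 / real k"
  proof (rule tendsto_sandwich)
    show "(\<lambda>n. 1 / real k - 1 / real n) \<longlonglongrightarrow> 1 / real k"
      using tendsto_diff [OF tendsto_const [of "1 / real k"] lim_const_over_n [of 1]] by simp
    show "(\<lambda>n. 1 / real k) \<longlonglongrightarrow> 1 / real k" by simp
    show "\<forall>\<^sub>F n in sequentially. 1 / real k - 1 / real n \<le> real (a n) / real n"
      using eventually_ge_at_top [of 1]
    proof eventually_elim
      case (elim n)
      have "n \<le> (a n + 1) * k"
        using elim assms dividend_less_div_times [of k "n - 1"] by (simp add: a_def)
      then have "real n \<le> (real (a n) + 1) * real k"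
        by (metis of_nat_1 of_nat_add of_nat_le_iff of_nat_mult)
      then have "real n / real k - 1 \<le> real (a n)" using assms by (simp add: field_simps)
      then have "(real n / real k - 1) / real n \<le> real (a n) / real n"
        by (intro divide_right_mono) simp_all
      then show ?case using elim by (simp add: diff_divide_distrib)
    qed
    show "\<forall>\<^sub>F n in sequentially. real (a n) / real n \<le> 1 / real k"
      using eventually_ge_at_top [of 1]
    proof eventually_elim
      case (elim n)
      have "a n * k \<le> n - 1" unfolding a_def by (rule div_times_less_eq_dividend)
      then have "a n * k \<le> n" by simp
      then have "real (a n) * real k \<le> real n" by (metis of_nat_le_iff of_nat_mult)
      then show ?case using elim assms by (simp add: field_simps)
    qed
  qed
  have lim_da: "(\<lambda>n. real (n - d - a n) / real n) \<longlonglongrightarrow> 1 - 1 / real k"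
  proof (rule Lim_transform_eventually)
    show "(\<lambda>n. real (n - d) / real n - real (a n) / real n) \<longlonglongrightarrow> 1 - 1 / real k"
      by (intro tendsto_diff lim_d lim_a)
    \<comment> \<open>The limit \<open>1 - 1 / k\<close> is positive, so eventually
      \<open>a n \<le> n - d\<close> and the truncated subtraction is exact.\<close>
    have "\<forall>\<^sub>F n in sequentially. 0 < real (n - d) / real n - real (a n) / real n"
      by (rule order_tendstoD(1) [OF tendsto_diff [OF lim_d lim_a]]) (use assms in simp)
    then show "\<forall>\<^sub>F n in sequentially.
        real (n - d) / real n - real (a n) / real n = real (n - d - a n) / real n"
      using eventually_gt_at_top [of 0]
    proof eventually_elim
      case (elim n)
      then have "a n \<le> n - d" by (simp add: field_simps)
      then show ?case by (simp only: of_nat_diff diff_divide_distrib)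
    qed
  qed

  have lim_binomial: "(\<lambda>n. scaled (real (n - d choose m)) n) \<longlonglongrightarrow> 1"
    using binomial_ratio_tendsto [OF lim_d, of m] by (simp add: scaled_def)
  have lim_threshold: "(\<lambda>n. scaled (real (pfm_threshold d k n)) n) \<longlonglongrightarrow> C"
  proof (rule tendsto_sandwich)
    have "(\<lambda>n. scaled (real (n - d choose m)) n - scaled (real (n - d - a n choose m)) n)
        \<longlonglongrightarrow> 1 - (1 - 1 / real k) ^ m"
      using binomial_ratio_tendsto [OF lim_da, of m]
      by (intro tendsto_diff lim_binomial) (simp add: scaled_def)
    then show "(\<lambda>n. scaled (real (n - d choose m) - real (n - d - a n choose m)) n) \<longlonglongrightarrow> C"
      using assms by (simp add: scaled_def C_def diff_divide_distrib right_diff_distrib)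
    \<comment> \<open>The scaled form of the summand 1 in the upper bound; it vanishes because
      \<open>0 < m\<close>.\<close>
    have "(\<lambda>n. fact m * inverse (real n ^ m)) \<longlonglongrightarrow> fact m * 0"
      by (intro tendsto_mult tendsto_const tendsto_inverse_0_at_top filterlim_pow_at_top m
          filterlim_real_sequentially)
    then have "(\<lambda>n. C + fact m / real n ^ m) \<longlonglongrightarrow> C + 0"
      by (intro tendsto_add tendsto_const) (simp add: divide_inverse)
    then show "(\<lambda>n. C + fact m / real n ^ m) \<longlonglongrightarrow> C" by simp
    show "\<forall>\<^sub>F n in sequentially.
        scaled (real (n - d choose m) - real (n - d - a n choose m)) n
          \<le> scaled (real (pfm_threshold d k n)) n"
      using eventually_ge_at_top [of k]
    proof eventually_elim
      case (elim n)
      show ?case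
        unfolding scaled_def using pfm_threshold_bounds(1) [OF d elim]
        by (intro divide_right_mono mult_left_mono) (simp_all add: m_def a_def)
    qed
    show "\<forall>\<^sub>F n in sequentially. scaled (real (pfm_threshold d k n)) n \<le> C + fact m / real n ^ m"
      using eventually_ge_at_top [of k]
    proof eventually_elim
      case (elim n)
      have "scaled (real (pfm_threshold d k n)) n \<le> scaled (real n ^ m * C / fact m + 1) n"
        unfolding scaled_def using pfm_threshold_bounds(2) [OF d elim]
        by (intro divide_right_mono mult_left_mono) (simp_all add: m_def C_def)
      also have "\<dots> = C + fact m / real n ^ m"
        using elim assms by (simp add: scaled_def field_simps)
      finally show ?case .
    qed
  qed
  \<comment> \<open>The common scaling cancels for \<open>n > 0\<close>, and
    \<open>C \<noteq> 0\<close> permits dividing the limits.\<close>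
  have "(\<lambda>n. real (pfm_threshold d k n) / (C * real (n - d choose m))) \<longlonglongrightarrow> 1"
  proof (rule Lim_transform_eventually)
    show "(\<lambda>n. scaled (real (pfm_threshold d k n)) n / (C * scaled (real (n - d choose m)) n)) \<longlonglongrightarrow> 1"
      using tendsto_divide [OF lim_threshold tendsto_mult [OF tendsto_const [of C] lim_binomial]]
        \<open>C \<noteq> 0\<close> by simp
    show "\<forall>\<^sub>F n in sequentially.
        scaled (real (pfm_threshold d k n)) n / (C * scaled (real (n - d choose m)) n)
          = real (pfm_threshold d k n) / (C * real (n - d choose m))"
      using eventually_gt_at_top [of 0] by eventually_elim (simp add: scaled_def)
  qed
  then show ?thesis
    unfolding m_def C_def by (rule asymp_equivI')
qed

end
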